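(* Let $X$ be an infinite-dimensional Banach space with the Radon--Nikodym property and let $\kappa\leq w^*\text{-}\mathrm{dens}\, X^*$ be a cardinal number with uncountable cofinality. Then, for some $\varepsilon>0$, the unit sphere of $X$ contains a symmetrically $(1+\varepsilon)$-separated subset, with cardinality $\kappa$.
   Context: Banach spaces are over the real or the complex field. $w^*\text{-}\mathrm{dens}\,X^*$ is the density character of $X^*$ in the $w^*$-topology. For $\delta>0$, a subset $A$ of a normed space is symmetrically $\delta$-separated if $\|x-y\|\geq\delta$ and $\|x+y\|\geq\delta$ for all distinct $x,y\in A$. *)

theory Defs
  imports "HOL-Analysis.Analysis"
begin

unbundle cardinal_syntax

section \<open>Banach spaces over the real or the complex field\<close>

text \<open>Normed fields that are isometrically isomorphic to the real or to the complex numbers.\<close>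

class real_or_complex = real_normed_field +
  assumes real_or_complex:
    "(\<exists>\<phi> :: 'a \<Rightarrow> real. bij \<phi> \<and> (\<forall>x y. \<phi> (x + y) = \<phi> x + \<phi> y) \<and>
       (\<forall>x y. \<phi> (x * y) = \<phi> x * \<phi> y) \<and> (\<forall>x. norm (\<phi> x) = norm x)) \<or>
     (\<exists>\<phi> :: 'a \<Rightarrow> complex. bij \<phi> \<and> (\<forall>x y. \<phi> (x + y) = \<phi> x + \<phi> y) \<and>
       (\<forall>x y. \<phi> (x * y) = \<phi> x * \<phi> y) \<and> (\<forall>x. norm (\<phi> x) = norm x))"

instance real :: real_or_complex
  by standard (rule disjI1, rule exI[of _ "\<lambda>x. x"], simp add: bij_def)

instance complex :: real_or_complex
  by standard (rule disjI2, rule exI[of _ "\<lambda>x. x"], simp add: bij_def)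

text \<open>The class \<^class>\<open>banach\<close> only provides real scalars.  A Banach space over the field
  \<open>'k\<close> is a (real) Banach space with a scalar multiplication by \<open>'k\<close> that extends the real
  one.\<close>

locale banach_space_over = vector_space scaleF
  for scaleF :: "'k::real_or_complex \<Rightarrow> 'a::banach \<Rightarrow> 'a" +
  assumes scaleF_of_real: "scaleF (of_real r) x = r *\<^sub>R x"
    and norm_scaleF: "norm (scaleF c x) = norm c * norm x"

lemma banach_space_over_real: "banach_space_over ((*\<^sub>R) :: real \<Rightarrow> 'a::banach \<Rightarrow> 'a)"
  by unfold_locales (auto simp: algebra_simps)

lemma banach_space_over_complex: "banach_space_over ((*) :: complex \<Rightarrow> complex \<Rightarrow> complex)"
  by unfold_locales (auto simp: algebra_simps norm_mult scaleR_conv_of_real)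

definition infinite_dimensional :: "('k::field \<Rightarrow> 'a::ab_group_add \<Rightarrow> 'a) \<Rightarrow> bool" where
  "infinite_dimensional scaleF \<longleftrightarrow> \<not> (\<exists>B. finite B \<and> module.span scaleF B = UNIV)"


section \<open>Weak-star density of the dual\<close>

definition dual_space :: "('k::real_or_complex \<Rightarrow> 'a::banach \<Rightarrow> 'a) \<Rightarrow> ('a \<Rightarrow> 'k) set" where
  "dual_space scaleF =
     {f. Vector_Spaces.linear scaleF (*) f \<and> (\<exists>K. \<forall>x. norm (f x) \<le> K * norm x)}"

text \<open>The topology of pointwise convergence on the dual.\<close>

definition weak_star_topology ::
    "('k::real_or_complex \<Rightarrow> 'a::banach \<Rightarrow> 'a) \<Rightarrow> ('a \<Rightarrow> 'k) topology" where
  "weak_star_topology scaleF =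
     subtopology (product_topology (\<lambda>_::'a. euclidean) UNIV) (dual_space scaleF)"

definition dense_in :: "'b topology \<Rightarrow> 'b set \<Rightarrow> bool" where
  "dense_in T D \<longleftrightarrow> D \<subseteq> topspace T \<and> T closure_of D = topspace T"

text \<open>Cardinals are represented as in \<^theory>\<open>HOL.BNF_Cardinal_Order_Relation\<close>; the density
  character is the cardinal of a dense set of least cardinality.\<close>

definition density_character :: "'b topology \<Rightarrow> 'b rel" where
  "density_character T =
     |SOME D. dense_in T D \<and> (\<forall>E. dense_in T E \<longrightarrow> |D| \<le>o |E| )|"

lemma density_character:
  shows density_character_attained: "\<exists>D. dense_in T D \<and> |D| =o density_character T"
    and density_character_least: "dense_in T E \<Longrightarrow> density_character T \<le>o |E|"
proof -
  let ?P = "\<lambda>D. dense_in T D \<and> (\<forall>E. dense_in T E \<longrightarrow> |D| \<le>o |E| )"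
  let ?R = "{|D| | D. dense_in T D}"
  have "dense_in T (topspace T)"
    by (simp add: dense_in_def)
  then have "?R \<noteq> {}" by blast
  moreover have "\<forall>r\<in>?R. Card_order r"
    using card_of_Card_order by blast
  ultimately have "\<exists>r\<in>?R. \<forall>r'\<in>?R. r \<le>o r'"
    by (rule exists_minim_Card_order)
  then have "\<exists>D. ?P D" by blast
  then have *: "?P (SOME D. ?P D)" by (rule someI_ex)
  show "\<exists>D. dense_in T D \<and> |D| =o density_character T"
    unfolding density_character_def using * card_of_refl by blast
  show "dense_in T E \<Longrightarrow> density_character T \<le>o |E|"
    unfolding density_character_def using * by blast
qed

text \<open>The library's \<^const>\<open>cofinal\<close> asks for strictly larger elements, so that a finite nonempty
  cardinal has no cofinal subset at all.  Finite cardinals are therefore excluded explicitly.\<close>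

definition uncountable_cofinality :: "'c rel \<Rightarrow> bool" where
  "uncountable_cofinality r \<longleftrightarrow>
     cinfinite r \<and> (\<forall>A \<subseteq> Field r. cofinal A r \<longrightarrow> \<not> countable A)"


section \<open>The Radon--Nikodym property\<close>

text \<open>The library's \<^const>\<open>has_bochner_integral\<close> is only available for second countable (i.e.
  separable) target spaces.  The following version works in an arbitrary Banach space; the
  integrand has to be the almost everywhere limit of a sequence of simple functions.\<close>

definition strongly_measurable :: "'w measure \<Rightarrow> ('w \<Rightarrow> 'a::banach) \<Rightarrow> bool" where
  "strongly_measurable M f \<longleftrightarrow>
     (\<exists>s. (\<forall>i::nat. simple_function M (s i)) \<and> (AE x in M. (\<lambda>i. s i x) \<longlonglongrightarrow> f x))"

definition has_banach_integral :: "'w measure \<Rightarrow> ('w \<Rightarrow> 'a::banach) \<Rightarrow> 'a \<Rightarrow> bool" where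
  "has_banach_integral M f I \<longleftrightarrow> strongly_measurable M f \<and>
     (\<exists>s. (\<forall>i::nat. Bochner_Integration.simple_bochner_integrable M (s i)) \<and>
          (\<lambda>i. \<integral>\<^sup>+x. norm (f x - s i x) \<partial>M) \<longlonglongrightarrow> 0 \<and>
          (\<lambda>i. Bochner_Integration.simple_bochner_integral M (s i)) \<longlonglongrightarrow> I)"

lemma has_bochner_integral_imp_has_banach_integral:
  fixes f :: "'w \<Rightarrow> 'a::{banach, second_countable_topology}"
  assumes "has_bochner_integral M f I"
  shows "has_banach_integral M f I"
  using assms
proof cases
  case (1 s)
  obtain F where "\<And>i. simple_function M (F i)"
    "\<And>x. x \<in> space M \<Longrightarrow> (\<lambda>i. F i x) \<longlonglongrightarrow> f x"
    using borel_measurable_implies_sequence_metric[OF 1(1), of 0] by metis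
  then have "strongly_measurable M f"
    unfolding strongly_measurable_def by (intro exI[of _ F]) auto
  then show ?thesis
    unfolding has_banach_integral_def using 1(2-4) by blast
qed

definition vector_measure :: "'w measure \<Rightarrow> ('w set \<Rightarrow> 'a::banach) \<Rightarrow> bool" where
  "vector_measure M G \<longleftrightarrow>
     (\<forall>A::nat \<Rightarrow> 'w set. range A \<subseteq> sets M \<longrightarrow> disjoint_family A \<longrightarrow>
        (\<lambda>i. G (A i)) sums G (\<Union>i. A i))"

definition of_bounded_variation :: "'w measure \<Rightarrow> ('w set \<Rightarrow> 'a::banach) \<Rightarrow> bool" where
  "of_bounded_variation M G \<longleftrightarrow>
     (\<exists>V. \<forall>P. finite P \<longrightarrow> P \<subseteq> sets M \<longrightarrow> disjoint P \<longrightarrow> (\<Sum>E\<in>P. norm (G E)) \<le> V)"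

definition continuous_wrt :: "'w measure \<Rightarrow> ('w set \<Rightarrow> 'a::banach) \<Rightarrow> bool" where
  "continuous_wrt M G \<longleftrightarrow>
     (\<forall>e>0. \<exists>d>0. \<forall>E\<in>sets M. measure M E < d \<longrightarrow> norm (G E) < e)"

definition radon_nikodym_wrt :: "'w measure \<Rightarrow> 'a::banach itself \<Rightarrow> bool" where
  "radon_nikodym_wrt M _ \<longleftrightarrow>
     (\<forall>G :: 'w set \<Rightarrow> 'a. vector_measure M G \<longrightarrow> of_bounded_variation M G \<longrightarrow>
        continuous_wrt M G \<longrightarrow>
        (\<exists>g. \<forall>E\<in>sets M. has_banach_integral M (\<lambda>x. indicator E x *\<^sub>R g x) (G E)))"

text \<open>One cannot quantify over all types of sample points.  Here \<open>M\<close> ranges over all finite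
  measures on arbitrary sigma-algebras on sets of real numbers; this contains Lebesgue measure on
  the unit interval, which already decides the Radon--Nikodym property (Diestel and Uhl,
  Vector Measures, Chapter V.3).  Only the underlying real structure of the space matters.\<close>

definition radon_nikodym_property :: "'a::banach itself \<Rightarrow> bool" where
  "radon_nikodym_property X \<longleftrightarrow>
     (\<forall>M::real measure. finite_measure M \<longrightarrow> radon_nikodym_wrt M X)"


section \<open>Symmetrically separated sets\<close>

definition symmetrically_separated :: "real \<Rightarrow> 'a::real_normed_vector set \<Rightarrow> bool" where
  "symmetrically_separated \<delta> A \<longleftrightarrow>
     (\<forall>x\<in>A. \<forall>y\<in>A. x \<noteq> y \<longrightarrow> norm (x - y) \<ge> \<delta> \<and> norm (x + y) \<ge> \<delta>)"

end

theory Submission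
  imports Defs "HOL-Library.Countable_Set_Type"
begin

text \<open>
By transfinite recursion along \<open>\<kappa>\<close> one chooses unit vectors \<open>x a\<close>, functionals \<open>f a\<close> and
numbers \<open>\<eta> a > 0\<close> such that all earlier functionals vanish at \<open>x a\<close>, and such that
\<open>norm (x a + y) \<ge> 1 + \<eta> a\<close> for every unit vector \<open>y\<close> at which \<open>f a\<close> and all earlier
functionals vanish. If \<open>b\<close> comes later than \<open>a\<close>, then both \<open>x b\<close> and \<open>- x b\<close> are such
vectors \<open>y\<close>, so that the norms of \<open>x a + x b\<close> and \<open>x a - x b\<close> are at least \<open>1 + \<eta> a\<close>. As \<open>\<kappa>\<close>
has uncountable cofinality, some \<open>n\<close> satisfies \<open>\<eta> a \<ge> 1 / n\<close> for \<open>\<kappa>\<close> many \<open>a\<close>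
(\<open>uncountable_cofinality_countable_cover\<close>), and these \<open>x a\<close> form the required set.

The recursion does not stop early, because the fewer than \<open>\<kappa>\<close> functionals chosen so far have
a common zero other than \<open>0\<close> (\<open>few_functionals_common_zero\<close>). Otherwise they would separate
points, and their combinations with coefficients from a countable dense set of scalars would
be weak-star dense.

For a single step (\<open>ex_next_vector\<close>), let \<open>Y\<close> be the common kernel of the earlier
functionals. It suffices to find a unit vector \<open>x \<in> Y\<close> and \<open>\<eta> > 0\<close> such that \<open>0\<close> is not in
the closed convex hull of the set \<open>C\<close> of all \<open>y \<in> Y\<close> with \<open>norm y \<ge> 1\<close> and
\<open>norm (x + y) < 1 + \<eta>\<close>: by the Hahn-Banach theorem (\<open>separate_convex_from_ball\<close>) there is
then a functional without zeros in \<open>C\<close>.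

Here the Radon-Nikodym property enters (\<open>rnp_convex_hull_avoids_zero\<close>). If \<open>0\<close> were in this
closed hull for all \<open>x\<close> and \<open>\<eta>\<close>, then every \<open>z \<in> Y\<close> would be a convex combination of points
of \<open>Y\<close> that are at distance at least \<open>1/4\<close> from \<open>z\<close> and whose norms are at most \<open>1\<close> or
hardly larger than that of \<open>z\<close> (\<open>spread_decomposition\<close>). Iterating this gives a bounded
martingale of step functions on the unit interval, whose values move by at least \<open>1/4\<close> in
every step. Its indefinite integrals converge to a vector measure of bounded variation. A
density of this measure would be the limit in mean of the martingale, which is impossible
(\<open>separated_martingale.not_radon_nikodym\<close>).\<close>

section \<open>Separation of convex sets\<close>

definition sublinear :: "('a::real_vector \<Rightarrow> real) \<Rightarrow> bool" where
  "sublinear p \<longleftrightarrow> (\<forall>x y. p (x + y) \<le> p x + p y) \<and> (\<forall>t>0. \<forall>x. p (t *\<^sub>R x) \<le> t * p x)"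

lemma sublinear_0: "sublinear p \<Longrightarrow> p 0 = 0"
  unfolding sublinear_def
proof (elim conjE)
  assume *: "\<forall>t>0. \<forall>x. p (t *\<^sub>R x) \<le> t * p x"
  from *[rule_format, of 2 0] *[rule_format, of "1/2" 0] show "p 0 = 0" by simp
qed

lemma sublinear_ge: "sublinear p \<Longrightarrow> - p (- x) \<le> p x"
proof -
  assume p: "sublinear p"
  then have "p (x + - x) \<le> p x + p (- x)" unfolding sublinear_def by blast
  then show ?thesis using sublinear_0[OF p] by simp
qed

text \<open>
The assumptions \<open>add\<close> and \<open>scale\<close> say that subadditivity and homogeneity hold up to a change
of the index. This covers a chain of sublinear functionals (take the smaller of two) and
also families that are not directed, which occur twice below.\<close>

lemma sublinear_INF:
  fixes q :: "'i \<Rightarrow> 'a::real_vector \<Rightarrow> real"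
  assumes "T \<noteq> {}"
    and lower: "\<And>t x. t \<in> T \<Longrightarrow> l x \<le> q t x"
    and add: "\<And>s t x y. s \<in> T \<Longrightarrow> t \<in> T \<Longrightarrow> \<exists>r\<in>T. q r (x + y) \<le> q s x + q t y"
    and scale: "\<And>t x c. t \<in> T \<Longrightarrow> 0 < c \<Longrightarrow> \<exists>r\<in>T. q r (c *\<^sub>R x) \<le> c * q t x"
  shows "sublinear (\<lambda>x. INF t\<in>T. q t x)"
    and "t \<in> T \<Longrightarrow> (INF t\<in>T. q t x) \<le> q t x"
proof -
  have bdd: "bdd_below ((\<lambda>t. q t x) ` T)" for x
    using lower by (intro bdd_belowI2) auto
  have INF_le: "(INF t\<in>T. q t x) \<le> q t x" if "t \<in> T" for t x
    using that by (intro cINF_lower bdd)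
  show "t \<in> T \<Longrightarrow> (INF t\<in>T. q t x) \<le> q t x" by (rule INF_le)
  show "sublinear (\<lambda>x. INF t\<in>T. q t x)"
    unfolding sublinear_def
  proof (intro conjI allI impI)
    fix x y
    have 1: "(INF t\<in>T. q t (x + y)) \<le> q s x + q t y" if st: "s \<in> T" "t \<in> T" for s t
      using add[OF st, of x y] INF_le[of _ "x + y"] by (meson order_trans)
    have "(INF t\<in>T. q t (x + y)) - q t y \<le> (INF t\<in>T. q t x)" if "t \<in> T" for t
      using that 1[OF _ that] \<open>T \<noteq> {}\<close>
        by (intro cINF_greatest) (auto simp: algebra_simps)
    then have "(INF t\<in>T. q t (x + y)) - (INF t\<in>T. q t x) \<le> (INF t\<in>T. q t y)"
      using \<open>T \<noteq> {}\<close> by (intro cINF_greatest) (auto simp: algebra_simps)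
    then show "(INF t\<in>T. q t (x + y)) \<le> (INF t\<in>T. q t x) + (INF t\<in>T. q t y)" by simp
  next
    fix c :: real and x assume "0 < c"
    have "(INF t\<in>T. q t (c *\<^sub>R x)) / c \<le> (INF t\<in>T. q t x)"
    proof (intro cINF_greatest \<open>T \<noteq> {}\<close>)
      fix t assume "t \<in> T"
      then obtain r where "r \<in> T" "q r (c *\<^sub>R x) \<le> c * q t x"
        using scale[OF _ \<open>0 < c\<close>] by blast
      then have "(INF t\<in>T. q t (c *\<^sub>R x)) \<le> c * q t x"
        using INF_le[of r] by (meson order_trans)
      then show "(INF t\<in>T. q t (c *\<^sub>R x)) / c \<le> q t x"
        using \<open>0 < c\<close> by (simp add: field_simps)
    qed
    then show "(INF t\<in>T. q t (c *\<^sub>R x)) \<le> c * (INF t\<in>T. q t x)"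
      using \<open>0 < c\<close> by (simp add: field_simps)
  qed
qed

text \<open>
The form of the Hahn-Banach theorem without a subspace: by Zorn's lemma there is a minimal
sublinear functional \<open>m\<close> below \<open>p\<close>, and minimality forces \<open>m (- y) = - m y\<close>, hence
linearity.\<close>

lemma hahn_banach_sublinear:
  fixes p :: "'a::real_vector \<Rightarrow> real"
  assumes p: "sublinear p"
  obtains u where "linear u" "\<And>x. u x \<le> p x"
proof -
  define A where "A = {q. sublinear q \<and> (\<forall>x. q x \<le> p x)}"
  define P where "P = (\<lambda>q q' :: 'a \<Rightarrow> real. \<forall>x. q' x \<le> q x)"
  have "\<exists>m\<in>A. \<forall>a\<in>A. P m a \<longrightarrow> a = m"
  proof (rule predicate_Zorn)
    show "partial_order_on A (relation_of P A)"
      by (rule partial_order_on_relation_ofI) (auto simp: P_def fun_eq_iff intro: order_trans antisym)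
  next
    fix C assume C: "C \<in> Chains (relation_of P A)"
    then have CA: "C \<subseteq> A"
      and lin: "\<And>a b. a \<in> C \<Longrightarrow> b \<in> C \<Longrightarrow> P a b \<or> P b a"
      by (auto simp: Chains_def relation_of_def)
    show "\<exists>u\<in>A. \<forall>a\<in>C. P a u"
    proof (cases "C = {}")
      case True then show ?thesis using p by (auto simp: A_def)
    next
      case False
      have lower: "- p (- x) \<le> q x" if "q \<in> C" for q x
      proof -
        have "sublinear q" "q (- x) \<le> p (- x)" using that CA by (auto simp: A_def)
        then show ?thesis using sublinear_ge[of q x] by linarith
      qed
      have add: "\<exists>r\<in>C. r (x + y) \<le> q x + q' y" if "q \<in> C" "q' \<in> C"
        for q q' x y
        using lin[OF that]
      proof
        assume "P q q'"
        moreover have "q' (x + y) \<le> q' x + q' y"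
          using that CA by (auto simp: A_def sublinear_def)
        ultimately show ?thesis
          using that by (intro bexI[of _ q']) (auto simp: P_def intro: order_trans)
      next
        assume "P q' q"
        moreover have "q (x + y) \<le> q x + q y" using that CA by (auto simp: A_def sublinear_def)
        ultimately show ?thesis
          using that by (intro bexI[of _ q]) (auto simp: P_def intro: order_trans)
      qed
      have scale: "\<exists>r\<in>C. r (c *\<^sub>R x) \<le> c * q x" if "q \<in> C" "0 < c"
        for q c x
        using that CA by (intro bexI[of _ q]) (auto simp: A_def sublinear_def)
      have I1: "sublinear (\<lambda>x. INF t\<in>C. t x)"
        by (rule sublinear_INF(1)[where q = "\<lambda>q. q" and l = "\<lambda>x. - p (- x)"];
            fact False lower add scale)
      have I2: "(INF t\<in>C. t x) \<le> t x" if "t \<in> C" for t x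
        by (rule sublinear_INF(2)[where q = "\<lambda>q. q" and l = "\<lambda>x. - p (- x)"];
            fact False lower add scale that)
      obtain q where "q \<in> C" using False by blast
      have "(\<lambda>x. INF t\<in>C. t x) \<in> A"
        using I1 I2[OF \<open>q \<in> C\<close>] CA \<open>q \<in> C\<close>
          by (force simp: A_def intro: order_trans)
      moreover have "P a (\<lambda>x. INF t\<in>C. t x)" if "a \<in> C" for a
        using I2[OF that] by (simp add: P_def)
      ultimately show ?thesis by blast
    qed
  qed
  then obtain m where m: "sublinear m" "\<And>x. m x \<le> p x"
    and min: "\<And>a. sublinear a \<Longrightarrow> (\<And>x. a x \<le> m x) \<Longrightarrow> a = m"
    unfolding A_def P_def by (auto, meson order_trans)
  have m_add: "m (x + y) \<le> m x + m y"
    and m_scale: "0 < t \<Longrightarrow> m (t *\<^sub>R x) \<le> t * m x" for x y t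
    using m(1) by (auto simp: sublinear_def)
  have m_hom: "m (t *\<^sub>R x) = t * m x" if "0 \<le> t" for t x
  proof (cases "t = 0")
    case True then show ?thesis using sublinear_0[OF m(1)] by simp
  next
    case False
    then have "0 < t" using that by simp
    then have "m ((1/t) *\<^sub>R (t *\<^sub>R x)) \<le> (1/t) * m (t *\<^sub>R x)"
      by (intro m_scale) simp
    then show ?thesis
      using m_scale[OF \<open>0 < t\<close>, of x] \<open>0 < t\<close> by (simp add: field_simps)
  qed
  have neg: "m (- y) = - m y" for y
  proof -
    \<comment> \<open>The infimum over \<open>t\<close> of the \<open>q t\<close> is sublinear
      and lies below \<open>m\<close>, so that it is \<open>m\<close>; now
      evaluate it at \<open>- y\<close> with \<open>t = 1\<close>.\<close>
    define q where "q = (\<lambda>t x. m (x + t *\<^sub>R y) - t * m y)"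
    have T: "{0::real..} \<noteq> {}" by auto
    have lower: "- m (- x) \<le> q t x" if "t \<in> {0..}" for t x
      using m_add[of "x + t *\<^sub>R y" "- x"] m_hom[of t y] that by (simp add: q_def)
    have add: "\<exists>r\<in>{0..}. q r (x + x') \<le> q s x + q t x'"
      if "s \<in> {0..}" "t \<in> {0..}" for s t x x'
      using that m_add[of "x + s *\<^sub>R y" "x' + t *\<^sub>R y"]
      by (intro bexI[of _ "s + t"]) (auto simp: q_def algebra_simps)
    have scale: "\<exists>r\<in>{0..}. q r (c *\<^sub>R x) \<le> c * q t x"
      if "t \<in> {0..}" "0 < c" for t x c
      using that m_scale[of c "x + t *\<^sub>R y"]
      by (intro bexI[of _ "c * t"]) (auto simp: q_def algebra_simps)
    note I = sublinear_INF[of "{0..}" "\<lambda>x. - m (- x)" q, OF T lower add scale]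
    have "(\<lambda>x. INF t\<in>{0..}. q t x) = m"
    proof (rule min)
      show "sublinear (\<lambda>x. INF t\<in>{0..}. q t x)" using I(1) .
      show "(INF t\<in>{0..}. q t x) \<le> m x" for x
        using I(2)[of 0 x] by (simp add: q_def)
    qed
    then have "m (- y) \<le> q 1 (- y)" using I(2)[of 1 "- y"] by (metis atLeast_iff zero_le_one)
    then have "m (- y) \<le> - m y" using sublinear_0[OF m(1)] by (simp add: q_def)
    then show ?thesis using sublinear_ge[OF m(1), of y] by simp
  qed
  have "m (x + y) = m x + m y" for x y
    using m_add[of x y] m_add[of "x + y" "- y"] neg[of y] by simp
  moreover have "m (t *\<^sub>R x) = t * m x" for t x
  proof (cases "0 \<le> t")
    case False
    then have "m (t *\<^sub>R x) = - m ((- t) *\<^sub>R x)" using neg[of "(-t) *\<^sub>R x"] by simp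
    also have "\<dots> = t * m x" using False m_hom[of "-t" x] by simp
    finally show ?thesis .
  qed (rule m_hom)
  ultimately have "linear m" by (intro linearI) simp_all
  then show ?thesis using m(2) that by blast
qed

text \<open>
The infimum over \<open>t \<ge> 0\<close> and \<open>k \<in> K\<close> of \<open>norm (x + t k) - t r\<close> is sublinear in \<open>x\<close>. It is at
most \<open>norm x\<close> (take \<open>t = 0\<close>) and at most \<open>- r\<close> at every \<open>- k\<close> (take \<open>t = 1\<close>), so every
linear functional below it separates.\<close>

lemma separate_convex_from_ball:
  fixes K :: "'a::real_normed_vector set"
  assumes K: "convex K" and r: "0 < r" "\<And>k. k \<in> K \<Longrightarrow> r \<le> norm k"
  obtains u :: "'a \<Rightarrow> real" where "linear u" "\<And>x. \<bar>u x\<bar> \<le> norm x" "\<And>k. k \<in> K \<Longrightarrow> r \<le> u k"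
proof (cases "K = {}")
  case True
  show ?thesis by (rule that[of "\<lambda>_. 0"]) (use True in \<open>auto intro!: linearI\<close>)
next
  case False
  define q where "q = (\<lambda>(t, k) (x::'a). norm (x + t *\<^sub>R k) - t * r)"
  let ?T = "{0::real..} \<times> K"
  have T: "?T \<noteq> {}" using False by auto
  have lower: "- norm x \<le> q t x" if T: "t \<in> ?T" for t x
  proof -
    obtain s k where t: "t = (s, k)" "0 \<le> s" "k \<in> K" using T by auto
    have "s * r \<le> s * norm k" using t r(2) by (intro mult_left_mono) auto
    moreover have "norm (s *\<^sub>R k) \<le> norm (x + s *\<^sub>R k) + norm x"
      using norm_triangle_ineq4[of "x + s *\<^sub>R k" x] by simp
    ultimately show ?thesis using t by (simp add: q_def)
  qed
  have add: "\<exists>r\<in>?T. q r (x + y) \<le> q s x + q t y" if T: "s \<in> ?T" "t \<in> ?T"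
    for s t x y
  proof -
    obtain a k b l where s: "s = (a, k)" "0 \<le> a" "k \<in> K"
      and t: "t = (b, l)" "0 \<le> b" "l \<in> K"
      using T by auto
    obtain j where j: "j \<in> K" "(a + b) *\<^sub>R j = a *\<^sub>R k + b *\<^sub>R l"
    proof (cases "a + b = 0")
      case True
      then have "a = 0" "b = 0" using s t by auto
      then show ?thesis using s that[of k] by simp
    next
      case False
      then have ab: "0 < a + b" using s t by simp
      have "(a / (a + b)) *\<^sub>R k + (b / (a + b)) *\<^sub>R l \<in> K"
        using K s t ab by (intro convexD) (auto simp flip: add_divide_distrib)
      then show ?thesis using ab by (intro that) (auto simp: scaleR_add_right)
    qed
    have "norm (x + y + (a + b) *\<^sub>R j) \<le> norm (x + a *\<^sub>R k) + norm (y + b *\<^sub>R l)"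
      using norm_triangle_ineq[of "x + a *\<^sub>R k" "y + b *\<^sub>R l"] j
        by (simp add: algebra_simps)
    then show ?thesis using s t j
      by (intro bexI[of _ "(a + b, j)"]) (auto simp: q_def algebra_simps)
  qed
  have scale: "\<exists>r\<in>?T. q r (c *\<^sub>R x) \<le> c * q t x" if T: "t \<in> ?T" "0 < c"
    for t x c
  proof -
    obtain s k where t: "t = (s, k)" "0 \<le> s" "k \<in> K" using T by auto
    have "norm (c *\<^sub>R x + (c * s) *\<^sub>R k) = c * norm (x + s *\<^sub>R k)"
      using \<open>0 < c\<close>
        by (metis abs_of_pos norm_scaleR scaleR_right_distrib scaleR_scaleR)
    then show ?thesis using t \<open>0 < c\<close>
      by (intro bexI[of _ "(c * s, k)"]) (auto simp: q_def algebra_simps)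
  qed
  note I = sublinear_INF[of ?T "\<lambda>x. - norm x" q, OF T lower add scale]
  obtain u where u: "linear u" "\<And>x. u x \<le> (INF t\<in>?T. q t x)"
    using hahn_banach_sublinear[OF I(1)] by blast
  obtain k0 where "k0 \<in> K" using False by blast
  have ub: "u x \<le> norm x" for x
    using u(2)[of x] I(2)[of "(0, k0)" x] \<open>k0 \<in> K\<close> by (simp add: q_def)
  have "\<bar>u x\<bar> \<le> norm x" for x
    using ub[of x] ub[of "- x"] linear_neg[OF u(1), of x] by (simp add: abs_le_iff)
  moreover have "r \<le> u k" if "k \<in> K" for k
    using u(2)[of "- k"] I(2)[of "(1, k)" "- k"] that linear_neg[OF u(1), of k] by (simp add: q_def)
  ultimately show ?thesis using u(1) that by blast
qed

section \<open>Integrals of strongly measurable functions\<close>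

text \<open>
Borel measurability of a function into a nonseparable space is of little use. What is needed
is that the distance to simple functions is measurable as a real function. This holds after
changing \<open>f\<close> on a null set, because then \<open>f\<close> is everywhere a limit of simple functions.\<close>

lemma strongly_measurable_representative:
  fixes f :: "'w \<Rightarrow> 'a::banach"
  assumes "strongly_measurable M f"
  obtains f' where "AE x in M. f' x = f x"
    "\<And>t. simple_function M t \<Longrightarrow> (\<lambda>x. norm (f' x - t x)) \<in> borel_measurable M"
proof -
  obtain s where s: "\<And>i. simple_function M (s i)"
    and lim: "AE x in M. (\<lambda>i. s i x) \<longlonglongrightarrow> f x"
    using assms unfolding strongly_measurable_def by blast
  obtain N where N: "{x \<in> space M. \<not> (\<lambda>i. s i x) \<longlonglongrightarrow> f x} \<subseteq> N" "emeasure M N = 0" "N \<in> sets M"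
    using AE_E[OF lim] by blast
  define f' where "f' x = (if x \<in> N then 0 else f x)" for x
  define s' where "s' i x = (if x \<in> N then 0 else s i x)" for i x
  have s': "simple_function M (s' i)" for i
  proof -
    have "simple_function M (\<lambda>x. (1 - indicator N x :: real) *\<^sub>R s i x)"
      by (rule simple_function_compose2[of _ "\<lambda>x. 1 - indicator N x" _ "(*\<^sub>R)"])
         (use N(3) s in auto)
    moreover have "(\<lambda>x. (1 - indicator N x :: real) *\<^sub>R s i x) = s' i"
      by (auto simp: s'_def fun_eq_iff)
    ultimately show ?thesis by simp
  qed
  have lim': "(\<lambda>i. s' i x) \<longlonglongrightarrow> f' x" if "x \<in> space M" for x
    using N(1) that by (cases "x \<in> N") (auto simp: f'_def s'_def)
  have "AE x in M. x \<notin> N" using N by (intro AE_not_in) auto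
  then have "AE x in M. f' x = f x" by eventually_elim (simp add: f'_def)
  moreover have "(\<lambda>x. norm (f' x - t x)) \<in> borel_measurable M" if "simple_function M t"
    for t
  proof (rule borel_measurable_LIMSEQ_real)
    show "(\<lambda>i. norm (s' i x - t x)) \<longlonglongrightarrow> norm (f' x - t x)"
      if "x \<in> space M" for x
      using lim'[OF that] by (intro tendsto_intros)
    show "(\<lambda>x. norm (s' i x - t x)) \<in> borel_measurable M" for i
      by (rule borel_measurable_simple_function,
          rule simple_function_compose2[of _ "s' i" t "\<lambda>x y. norm (x - y)"]) (use s' that in auto)
  qed
  ultimately show ?thesis using that by blast
qed

text \<open>
The integral of \<open>g - c\<close> over \<open>E\<close> is \<open>z - measure M E *\<^sub>R c\<close>, and the norm of an integral is
at most the integral of the norm. The function \<open>g\<close> is the representative of \<open>f\<close> from the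
previous lemma.\<close>

lemma has_banach_integral_deviation:
  fixes g :: "'w \<Rightarrow> 'a::banach"
  assumes "finite_measure M" and E: "E \<in> sets M"
    and int: "has_banach_integral M (\<lambda>x. indicator E x *\<^sub>R f x) z"
    and ae: "AE x in M. g x = f x"
    and meas: "\<And>t. simple_function M t \<Longrightarrow> (\<lambda>x. norm (g x - t x)) \<in> borel_measurable M"
  shows "ennreal (norm (z - measure M E *\<^sub>R c)) \<le> (\<integral>\<^sup>+x\<in>E. ennreal (norm (g x - c)) \<partial>M)"
proof -
  interpret finite_measure M by fact
  obtain s where s: "\<And>i::nat. Bochner_Integration.simple_bochner_integrable M (s i)"
    and s0: "(\<lambda>i. \<integral>\<^sup>+x. norm (indicator E x *\<^sub>R f x - s i x) \<partial>M) \<longlonglongrightarrow> 0"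
    and sz: "(\<lambda>i. Bochner_Integration.simple_bochner_integral M (s i)) \<longlonglongrightarrow> z"
    using int unfolding has_banach_integral_def by blast
  have simp_s: "simple_function M (s i)" for i using s[of i] by cases
  have [measurable]: "E \<in> sets M" by fact
  have eq: "(\<integral>\<^sup>+x. norm (indicator E x *\<^sub>R f x - s i x) \<partial>M) = (\<integral>\<^sup>+x. norm (indicator E x *\<^sub>R g x - s i x) \<partial>M)" for i
    by (rule nn_integral_cong_AE) (use ae in eventually_elim, simp)
  define k where "k x = indicator E x *\<^sub>R c" for x
  have k_simple: "simple_function M k"
    unfolding k_def
      by (rule simple_function_compose1[of _ "indicator E :: _ \<Rightarrow> real" "\<lambda>r. r *\<^sub>R c"]) (use E in auto)
  have k_int: "Bochner_Integration.simple_bochner_integrable M k"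
    by (rule simple_bochner_integrable.intros[OF k_simple]) simp
  have Sk: "Bochner_Integration.simple_bochner_integral M k = measure M E *\<^sub>R c"
  proof -
    have 1: "Bochner_Integration.simple_bochner_integrable M (indicator E :: _ \<Rightarrow> real)"
      by (rule simple_bochner_integrable.intros) (use E in auto)
    have "Bochner_Integration.simple_bochner_integral M k = Bochner_Integration.simple_bochner_integral M (indicator E :: _ \<Rightarrow> real) *\<^sub>R c"
      unfolding k_def
        by (rule simple_bochner_integral_linear[OF _ 1]) (simp add: linear_iff algebra_simps)
    also have "Bochner_Integration.simple_bochner_integral M (indicator E :: _ \<Rightarrow> real) = measure M E"
    proof -
      have "ennreal (Bochner_Integration.simple_bochner_integral M (indicator E :: _ \<Rightarrow> real)) = (\<integral>\<^sup>+x. ennreal (indicator E x) \<partial>M)"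
        by (rule simple_bochner_integral_eq_nn_integral[OF 1]) auto
      also have "\<dots> = ennreal (measure M E)"
        using E by (simp add: ennreal_indicator emeasure_eq_measure)
      finally show ?thesis by (subst (asm) ennreal_inj) (auto intro: simple_bochner_integral_nonneg)
    qed
    finally show ?thesis .
  qed
  let ?d = "\<lambda>i. \<integral>\<^sup>+x. norm (indicator E x *\<^sub>R g x - s i x) \<partial>M"
  let ?r = "\<integral>\<^sup>+x\<in>E. ennreal (norm (g x - c)) \<partial>M"
  have *: "ennreal (norm (Bochner_Integration.simple_bochner_integral M (s i) - measure M E *\<^sub>R c)) \<le> ?d i + ?r" for i
  proof -
    have sk: "Bochner_Integration.simple_bochner_integrable M (\<lambda>x. s i x - k x)"
      by (rule simple_bochner_integrable_compose2[OF _ s k_int]) simp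
    have [measurable]: "(\<lambda>x. norm (indicator E x *\<^sub>R g x - s i x)) \<in> borel_measurable M"
    proof -
      have "(\<lambda>x. norm (s i x)) \<in> borel_measurable M"
        by (rule borel_measurable_simple_function, rule simple_function_compose1) (rule simp_s)
      then have "(\<lambda>x. if x \<in> E then norm (g x - s i x) else norm (s i x)) \<in> borel_measurable M"
        using meas[OF simp_s[of i]] by (intro measurable_If) auto
      moreover have "(\<lambda>x. if x \<in> E then norm (g x - s i x) else norm (s i x))
          = (\<lambda>x. norm (indicator E x *\<^sub>R g x - s i x))" by (auto simp: fun_eq_iff)
      ultimately show ?thesis by simp
    qed
    have [measurable]: "(\<lambda>x. norm (g x - c)) \<in> borel_measurable M"
      by (rule meas) auto
    have "Bochner_Integration.simple_bochner_integral M (s i) - measure M E *\<^sub>R c = Bochner_Integration.simple_bochner_integral M (\<lambda>x. s i x - k x)"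
      using simple_bochner_integral_diff[OF s[of i] k_int] Sk by simp
    then have "ennreal (norm (Bochner_Integration.simple_bochner_integral M (s i) - measure M E *\<^sub>R c)) \<le> ennreal (Bochner_Integration.simple_bochner_integral M (\<lambda>x. norm (s i x - k x)))"
      using simple_bochner_integral_norm_bound[OF sk] by (simp add: ennreal_leI)
    also have "\<dots> = (\<integral>\<^sup>+x. norm (s i x - k x) \<partial>M)"
      by (rule simple_bochner_integral_eq_nn_integral)
         (use simple_bochner_integrable_compose2[OF _ s[of i] k_int, of "\<lambda>x y. norm (x - y)"] in auto)
    also have "\<dots> \<le> (\<integral>\<^sup>+x. ennreal (norm (indicator E x *\<^sub>R g x - s i x)) + ennreal (norm (g x - c)) * indicator E x \<partial>M)"
    proof (rule nn_integral_mono)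
      fix x
      have "norm (s i x - c) \<le> norm (g x - s i x) + norm (g x - c)"
        using norm_triangle_ineq4[of "g x - c" "g x - s i x"] by (simp add: add.commute)
      then show "ennreal (norm (s i x - k x)) \<le> ennreal (norm (indicator E x *\<^sub>R g x - s i x)) + ennreal (norm (g x - c)) * indicator E x"
        by (cases "x \<in> E") (auto simp: k_def simp flip: ennreal_plus intro: ennreal_leI)
    qed
    also have "\<dots> = ?d i + ?r" by (rule nn_integral_add) auto
    finally show ?thesis .
  qed
  have L1: "(\<lambda>i. ?d i + ?r) \<longlonglongrightarrow> 0 + ?r"
    using s0 unfolding eq by (intro tendsto_intros)
  have L2: "(\<lambda>i. ennreal (norm (Bochner_Integration.simple_bochner_integral M (s i) - measure M E *\<^sub>R c))) \<longlonglongrightarrow> ennreal (norm (z - measure M E *\<^sub>R c))"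
    using sz by (intro tendsto_intros)
  show ?thesis using LIMSEQ_le[OF L2 L1] * by auto
qed

section \<open>Martingales with separated values\<close>

text \<open>
A bounded martingale of step functions on an increasing sequence of finite partitions, whose
values move by at least \<open>\<delta>\<close> from each partition to the next. The set \<open>R n\<close> consists of the
pairs of a cell of the \<open>n\<close>-th partition and the value on that cell. The tree structure is
left implicit: the children of a cell are the cells of the next partition that it contains.\<close>

locale separated_martingale = finite_measure M
  for M :: "'w measure" +
  fixes R :: "nat \<Rightarrow> ('w set \<times> 'a::banach) set" and B \<delta> :: real
  assumes finite_level: "finite (R n)"
    and cell_sets: "p \<in> R n \<Longrightarrow> fst p \<in> sets M"
    and cell_pos: "p \<in> R n \<Longrightarrow> 0 < measure M (fst p)"
    and cells_disjoint: "p \<in> R n \<Longrightarrow> q \<in> R n \<Longrightarrow> p \<noteq> q \<Longrightarrow> fst p \<inter> fst q = {}"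
    and cells_cover: "(\<Union>p\<in>R n. fst p) = space M"
    and bounded: "p \<in> R n \<Longrightarrow> norm (snd p) \<le> B"
    and parent: "q \<in> R (Suc n) \<Longrightarrow> \<exists>p\<in>R n. fst q \<subseteq> fst p"
    and average: "p \<in> R n \<Longrightarrow>
      (\<Sum>q | q \<in> R (Suc n) \<and> fst q \<subseteq> fst p. measure M (fst q) *\<^sub>R snd q) = measure M (fst p) *\<^sub>R snd p"
    and separated: "p \<in> R n \<Longrightarrow> q \<in> R (Suc n) \<Longrightarrow> fst q \<subseteq> fst p \<Longrightarrow> \<delta> \<le> norm (snd q - snd p)"
    and generated: "sets M = sigma_sets (space M) (\<Union>n. fst ` R n)"
    and space_pos: "0 < measure M (space M)"
    and \<delta>_pos: "0 < \<delta>"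
begin

definition children :: "nat \<Rightarrow> 'w set \<times> 'a \<Rightarrow> ('w set \<times> 'a) set" where
  "children n p = {q \<in> R (Suc n). fst q \<subseteq> fst p}"

text \<open>The indefinite integral of the \<open>n\<close>-th step function.\<close>

definition level_measure :: "nat \<Rightarrow> 'w set \<Rightarrow> 'a" where
  "level_measure n E = (\<Sum>p\<in>R n. measure M (E \<inter> fst p) *\<^sub>R snd p)"

text \<open>The values converge for every set in \<open>M\<close>; see \<open>level_measure_tendsto\<close>.\<close>

definition \<nu> :: "'w set \<Rightarrow> 'a" where
  "\<nu> E = lim (\<lambda>n. level_measure n E)"

definition cell_unions :: "nat \<Rightarrow> 'w set set" where
  "cell_unions n = {A. A \<subseteq> space M \<and> (\<forall>p\<in>R n. fst p \<subseteq> A \<or> fst p \<inter> A = {})}"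

lemma cell_subset_space: "p \<in> R n \<Longrightarrow> fst p \<subseteq> space M"
  using cells_cover by blast

lemma cell_nonempty: "p \<in> R n \<Longrightarrow> fst p \<noteq> {}"
  using cell_pos[of p n] by (cases "fst p = {}") auto

lemma B_nonneg: "0 \<le> B"
proof -
  have "space M \<noteq> {}" using space_pos by force
  then obtain p where "p \<in> R 0" using cells_cover[of 0] by blast
  then show ?thesis using bounded norm_ge_zero order_trans by blast
qed

lemma sum_measure_cells:
  assumes "E \<in> sets M"
  shows "(\<Sum>p\<in>R n. measure M (E \<inter> fst p)) = measure M E"
proof -
  have "measure M (\<Union>p\<in>R n. E \<inter> fst p) = (\<Sum>p\<in>R n. measure M (E \<inter> fst p))"
  proof (intro finite_measure_finite_Union finite_level)
    show "disjoint_family_on (\<lambda>p. E \<inter> fst p) (R n)"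
      unfolding disjoint_family_on_def using cells_disjoint by blast
  qed (use assms cell_sets in blast)
  moreover have "(\<Union>p\<in>R n. E \<inter> fst p) = E"
    using cells_cover[of n] sets.sets_into_space[OF assms] by blast
  ultimately show ?thesis by simp
qed

lemma level_measure_diff:
  assumes E: "E \<in> sets M" and F: "F \<in> sets M"
  shows "norm (level_measure n E - level_measure n F) \<le> B * measure M (sym_diff E F)"
proof -
  let ?S = "sym_diff E F"
  have le: "measure M (X \<inter> I) \<le> measure M (Y \<inter> I) + measure M (?S \<inter> I)"
    if "X = E \<and> Y = F \<or> X = F \<and> Y = E" "I \<in> sets M" for X Y I
  proof -
    have "measure M (X \<inter> I) \<le> measure M ((Y \<inter> I) \<union> (?S \<inter> I))"
      using that E F by (intro finite_measure_mono) auto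
    also have "\<dots> \<le> measure M (Y \<inter> I) + measure M (?S \<inter> I)"
      using that E F by (intro measure_Un_le) auto
    finally show ?thesis .
  qed
  have "level_measure n E - level_measure n F = (\<Sum>p\<in>R n. (measure M (E \<inter> fst p) - measure M (F \<inter> fst p)) *\<^sub>R snd p)"
    by (simp add: level_measure_def sum_subtractf scaleR_diff_left)
  also have "norm \<dots> \<le> (\<Sum>p\<in>R n. measure M (?S \<inter> fst p) * B)"
  proof (rule order_trans[OF norm_sum], rule sum_mono)
    fix p assume p: "p \<in> R n"
    have "\<bar>measure M (E \<inter> fst p) - measure M (F \<inter> fst p)\<bar> \<le> measure M (?S \<inter> fst p)"
      using le[of E F "fst p"] le[of F E "fst p"] cell_sets[OF p] by (simp add: abs_le_iff)
    then show "norm ((measure M (E \<inter> fst p) - measure M (F \<inter> fst p)) *\<^sub>R snd p)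
        \<le> measure M (?S \<inter> fst p) * B"
      using bounded[OF p] by (auto intro!: mult_mono)
  qed
  also have "\<dots> = B * measure M ?S"
    using E F by (simp add: sum_measure_cells flip: sum_distrib_right)
  finally show ?thesis .
qed

lemma level_measure_empty [simp]: "level_measure n {} = 0"
  by (simp add: level_measure_def)

lemma level_measure_Un:
  assumes "E \<in> sets M" "F \<in> sets M" "E \<inter> F = {}"
  shows "level_measure n (E \<union> F) = level_measure n E + level_measure n F"
proof -
  have "measure M ((E \<union> F) \<inter> fst p) = measure M (E \<inter> fst p) + measure M (F \<inter> fst p)" if "p \<in> R n" for p
    unfolding Int_Un_distrib2 using assms cell_sets[OF that]
    by (intro finite_measure_Union) auto
  then show ?thesis by (simp add: level_measure_def scaleR_add_left sum.distrib)
qed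

lemma cell_union_sets: "A \<in> cell_unions n \<Longrightarrow> A \<in> sets M"
proof -
  assume A: "A \<in> cell_unions n"
  have "A = (\<Union>p\<in>{p \<in> R n. fst p \<subseteq> A}. fst p)"
  proof
    show "A \<subseteq> (\<Union>p\<in>{p \<in> R n. fst p \<subseteq> A}. fst p)"
    proof
      fix x assume x: "x \<in> A"
      then have "x \<in> space M" using A by (auto simp: cell_unions_def)
      then obtain p where p: "p \<in> R n" "x \<in> fst p" using cells_cover[of n] by blast
      then have "fst p \<subseteq> A" using A x unfolding cell_unions_def by blast
      then show "x \<in> (\<Union>p\<in>{p \<in> R n. fst p \<subseteq> A}. fst p)" using p by blast
    qed
  qed blast
  also have "\<dots> \<in> sets M"
    using finite_level cell_sets by (intro sets.finite_UN) auto
  finally show ?thesis .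
qed

lemma cell_union_mono: "n \<le> m \<Longrightarrow> cell_unions n \<subseteq> cell_unions m"
proof (induction rule: dec_induct)
  case (step m)
  have "cell_unions m \<subseteq> cell_unions (Suc m)"
  proof
    fix A assume A: "A \<in> cell_unions m"
    have "fst q \<subseteq> A \<or> fst q \<inter> A = {}" if "q \<in> R (Suc m)" for q
    proof -
      obtain p where "p \<in> R m" "fst q \<subseteq> fst p"
        using parent[OF \<open>q \<in> R (Suc m)\<close>] by blast
      moreover have "fst p \<subseteq> A \<or> fst p \<inter> A = {}"
        using A \<open>p \<in> R m\<close> unfolding cell_unions_def by blast
      ultimately show ?thesis by auto
    qed
    then show "A \<in> cell_unions (Suc m)" using A by (auto simp: cell_unions_def)
  qed
  then show ?case using step by blast
qed simp

lemma cell_union_compl: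
  assumes A: "A \<in> cell_unions n"
  shows "space M - A \<in> cell_unions n"
  unfolding cell_unions_def
proof (intro CollectI conjI ballI)
  fix p assume p: "p \<in> R n"
  then have "fst p \<subseteq> A \<or> fst p \<inter> A = {}"
    using A unfolding cell_unions_def by blast
  then show "fst p \<subseteq> space M - A \<or> fst p \<inter> (space M - A) = {}"
    using cell_subset_space[OF p] by auto
qed simp

lemma cell_union_Un:
  assumes A: "A \<in> cell_unions n" and A': "A' \<in> cell_unions n"
  shows "A \<union> A' \<in> cell_unions n"
  unfolding cell_unions_def
proof (intro CollectI conjI ballI)
  show "A \<union> A' \<subseteq> space M" using A A' by (auto simp: cell_unions_def)
  fix p assume p: "p \<in> R n"
  then have "fst p \<subseteq> A \<or> fst p \<inter> A = {}" "fst p \<subseteq> A' \<or> fst p \<inter> A' = {}"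
    using A A' unfolding cell_unions_def by blast+
  then show "fst p \<subseteq> A \<union> A' \<or> fst p \<inter> (A \<union> A') = {}" by auto
qed

lemma cell_union_empty: "{} \<in> cell_unions n"
  unfolding cell_unions_def by blast

lemma cell_union_cell:
  assumes p: "p \<in> R n"
  shows "fst p \<in> cell_unions n"
  unfolding cell_unions_def
proof (intro CollectI conjI ballI)
  show "fst p \<subseteq> space M" using p by (rule cell_subset_space)
  show "fst q \<subseteq> fst p \<or> fst q \<inter> fst p = {}" if "q \<in> R n" for q
    using cells_disjoint[OF that p] by (cases "q = p") auto
qed

lemma R_Suc_eq: "R (Suc n) = (\<Union>p\<in>R n. children n p)"
proof
  show "R (Suc n) \<subseteq> (\<Union>p\<in>R n. children n p)"
  proof
    fix q assume "q \<in> R (Suc n)"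
    then show "q \<in> (\<Union>p\<in>R n. children n p)"
      using parent[of q n] by (auto simp: children_def)
  qed
qed (auto simp: children_def)

lemma finite_children: "finite (children n p)"
  using finite_level[of "Suc n"] by (simp add: children_def)

lemma cell_eq_Union_children: "p \<in> R n \<Longrightarrow> fst p = (\<Union>q\<in>children n p. fst q)"
proof -
  assume p: "p \<in> R n"
  have "x \<in> (\<Union>q\<in>children n p. fst q)" if x: "x \<in> fst p" for x
  proof -
    obtain q where q: "q \<in> R (Suc n)" "x \<in> fst q"
      using x cell_subset_space[OF p] cells_cover[of "Suc n"] by blast
    obtain p' where "p' \<in> R n" "fst q \<subseteq> fst p'" using parent[OF q(1)] by blast
    then have "p' = p" using cells_disjoint[OF p, of p'] q x by blast
    then have "q \<in> children n p"
      using q \<open>fst q \<subseteq> fst p'\<close> by (simp add: children_def)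
    then show ?thesis using q by blast
  qed
  then show ?thesis by (auto simp: children_def)
qed

text \<open>On unions of cells of level \<open>n\<close>, this is the martingale property.\<close>

lemma level_measure_Suc:
  assumes A: "A \<in> cell_unions n"
  shows "level_measure (Suc n) A = level_measure n A"
proof -
  have "level_measure (Suc n) A = (\<Sum>p\<in>R n. \<Sum>q\<in>children n p. measure M (A \<inter> fst q) *\<^sub>R snd q)"
    unfolding level_measure_def R_Suc_eq
  proof (rule sum.UNION_disjoint)
    show "\<forall>p\<in>R n. \<forall>p'\<in>R n. p \<noteq> p' \<longrightarrow> children n p \<inter> children n p' = {}"
    proof (intro ballI impI)
      fix p p' assume "p \<in> R n" "p' \<in> R n" "p \<noteq> p'"
      then have d: "fst p \<inter> fst p' = {}" by (rule cells_disjoint)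
      show "children n p \<inter> children n p' = {}"
        unfolding children_def using d cell_nonempty[of _ "Suc n"] by blast
    qed
  qed (use finite_level finite_children in auto)
  also have "\<dots> = (\<Sum>p\<in>R n. measure M (A \<inter> fst p) *\<^sub>R snd p)"
  proof (rule sum.cong[OF refl])
    fix p assume p: "p \<in> R n"
    consider "fst p \<subseteq> A" | "fst p \<inter> A = {}"
      using A p unfolding cell_unions_def by blast
    then show "(\<Sum>q\<in>children n p. measure M (A \<inter> fst q) *\<^sub>R snd q) = measure M (A \<inter> fst p) *\<^sub>R snd p"
    proof cases
      case 1
      then have "A \<inter> fst p = fst p" "\<And>q. q \<in> children n p \<Longrightarrow> A \<inter> fst q = fst q"
        by (auto simp: children_def)
      then show ?thesis using average[OF p] by (simp add: children_def)
    next
      case 2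
      then have "A \<inter> fst p = {}" "\<And>q. q \<in> children n p \<Longrightarrow> A \<inter> fst q = {}"
        by (auto simp: children_def)
      then show ?thesis by simp
    qed
  qed
  finally show ?thesis by (simp add: level_measure_def)
qed

lemma level_measure_stable:
  assumes A: "A \<in> cell_unions n" and "n \<le> m"
  shows "level_measure m A = level_measure n A"
  using \<open>n \<le> m\<close>
proof (induction m rule: dec_induct)
  case (step m)
  then have "A \<in> cell_unions m" using A cell_union_mono by blast
  then show ?case using step level_measure_Suc by simp
qed simp

text \<open>
The sets that can be approximated by unions of cells form a sigma-algebra, and \<open>M\<close> is
generated by the cells.\<close>

lemma approx_by_cells:
  assumes "E \<in> sets M" "0 < e"
  shows "\<exists>n. \<exists>A\<in>cell_unions n. measure M (sym_diff E A) < e"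
  using assms(1)[unfolded generated] assms(2)
proof (induction arbitrary: e rule: sigma_sets.induct)
  case (Basic a)
  then obtain n p where "p \<in> R n" "a = fst p" by blast
  then show ?case using cell_union_cell Basic by (intro exI[of _ n] bexI[of _ a]) auto
next
  case Empty
  then show ?case using cell_union_empty by (intro exI bexI[of _ "{}"]) auto
next
  case (Compl a)
  obtain n A where A: "A \<in> cell_unions n" "measure M (sym_diff a A) < e"
    using Compl by blast
  have "a \<subseteq> space M"
    using Compl(1) generated sets.sets_into_space by blast
  then have "((space M - a) - (space M - A)) \<union> ((space M - A) - (space M - a)) = sym_diff a A"
    using A by (auto simp: cell_unions_def)
  then show ?case using A cell_union_compl by (intro exI[of _ n] bexI[of _ "space M - A"]) auto
next
  case (Union a)
  then have a: "a i \<in> sets M" for i using generated by simp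
  have finite_approx: "\<exists>n. \<exists>A\<in>cell_unions n. measure M (((\<Union>i<k. a i) - A) \<union> (A - (\<Union>i<k. a i))) < d"
    if "0 < d" for d k
    using that
  proof (induction k arbitrary: d)
    case 0
    then show ?case using cell_union_empty by (intro exI bexI[of _ "{}"]) auto
  next
    case (Suc k)
    let ?U = "\<Union>i<k. a i"
    obtain n A where A: "A \<in> cell_unions n" "measure M (sym_diff ?U A) < d / 2"
      using Suc.IH[of "d/2"] Suc.prems by auto
    obtain n' A' where A': "A' \<in> cell_unions n'" "measure M (sym_diff (a k) A') < d / 2"
      using Union.IH[of "d/2" k] Suc.prems by auto
    have "measure M (((\<Union>i<Suc k. a i) - (A \<union> A')) \<union> ((A \<union> A') - (\<Union>i<Suc k. a i)))
        \<le> measure M ((sym_diff ?U A) \<union> (sym_diff (a k) A'))"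
      using a cell_union_sets[OF A(1)] cell_union_sets[OF A'(1)]
      by (intro finite_measure_mono sets.Un sets.Diff sets.finite_UN) (auto simp: less_Suc_eq)
    also have "\<dots> \<le> measure M (sym_diff ?U A) + measure M (sym_diff (a k) A')"
      using a cell_union_sets[OF A(1)] cell_union_sets[OF A'(1)]
      by (intro measure_Un_le sets.Un sets.Diff sets.finite_UN) auto
    also have "\<dots> < d" using A A' by simp
    finally show ?case
      using A(1) A'(1) cell_union_mono[of n "max n n'"] cell_union_mono[of n' "max n n'"]
      by (intro exI[of _ "max n n'"] bexI[of _ "A \<union> A'"] cell_union_Un) auto
  qed
  let ?V = "\<Union>i. a i"
  have V: "?V \<in> sets M" using a by blast
  have "(\<lambda>k. measure M (\<Union>i<k. a i)) \<longlonglongrightarrow> measure M (\<Union>k. \<Union>i<k. a i)"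
    using a by (intro finite_Lim_measure_incseq) (auto simp: incseq_def intro: less_le_trans)
  also have "(\<Union>k. \<Union>i<k. a i) = ?V" by auto
  finally have "\<forall>\<^sub>F k in sequentially. measure M ?V - e / 2 < measure M (\<Union>i<k. a i)"
    using \<open>0 < e\<close> by (intro order_tendstoD(1)) auto
  then obtain k where k: "measure M ?V - measure M (\<Union>i<k. a i) < e / 2"
    by (metis (no_types, lifting) add.commute diff_less_eq eventually_happens' sequentially_bot)
  let ?U = "\<Union>i<k. a i"
  have U: "?U \<in> sets M" "?U \<subseteq> ?V" using a by auto
  then have UV: "measure M (?V - ?U) < e / 2" using k V by (subst finite_measure_Diff) auto
  obtain n A where A: "A \<in> cell_unions n" "measure M (sym_diff ?U A) < e / 2"
    using finite_approx[of "e/2" k] \<open>0 < e\<close> by auto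
  have "measure M (sym_diff ?V A) \<le> measure M ((?V - ?U) \<union> (sym_diff ?U A))"
    using U V cell_union_sets[OF A(1)] by (intro finite_measure_mono sets.Un sets.Diff) auto
  also have "\<dots> \<le> measure M (?V - ?U) + measure M (sym_diff ?U A)"
    using U V cell_union_sets[OF A(1)] by (intro measure_Un_le sets.Un sets.Diff) auto
  also have "\<dots> < e" using A UV by simp
  finally show ?case using A(1) by blast
qed

text \<open>
On a union of cells the sequence is eventually constant, and all its members are Lipschitz
with the same constant \<open>B\<close> for the distance \<open>measure M (sym_diff E F)\<close> of sets.\<close>

lemma level_measure_tendsto:
  assumes E: "E \<in> sets M"
  shows "(\<lambda>n. level_measure n E) \<longlonglongrightarrow> \<nu> E"
proof -
  have "Cauchy (\<lambda>n. level_measure n E)"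
  proof (rule CauchyI)
    fix e :: real assume "0 < e"
    then have "0 < e / (2 * (B + 1))" using B_nonneg by simp
    then obtain n A where A: "A \<in> cell_unions n" "measure M (sym_diff E A) < e / (2 * (B + 1))"
      using approx_by_cells[OF E] by blast
    then have "measure M (sym_diff E A) * (2 * (B + 1)) < e"
      using B_nonneg by (simp add: pos_less_divide_eq)
    then have small: "2 * (B * measure M (sym_diff E A)) < e"
    proof -
      have "2 * (B * m) \<le> m * (2 * (B + 1))" if "0 \<le> m" for m :: real
        using that by (simp add: algebra_simps)
      then show ?thesis
        using \<open>_ * (2 * (B + 1)) < e\<close> measure_nonneg[of M "sym_diff E A"]
        by (meson le_less_trans)
    qed
    have "norm (level_measure k E - level_measure m E) < e" if "n \<le> k" "n \<le> m" for k m
    proof -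
      have "level_measure k A = level_measure m A"
        using level_measure_stable[OF A(1) that(1)] level_measure_stable[OF A(1) that(2)] by metis
      then have "level_measure k E - level_measure m E = (level_measure k E - level_measure k A) - (level_measure m E - level_measure m A)" by simp
      then have "norm (level_measure k E - level_measure m E) \<le> norm (level_measure k E - level_measure k A) + norm (level_measure m E - level_measure m A)"
        by (metis norm_triangle_ineq4)
      also have "\<dots> < e"
        using small level_measure_diff[OF E cell_union_sets[OF A(1)], of k] level_measure_diff[OF E cell_union_sets[OF A(1)], of m] by simp
      finally show ?thesis .
    qed
    then show "\<exists>n. \<forall>k\<ge>n. \<forall>m\<ge>n. norm (level_measure k E - level_measure m E) < e" by blast
  qed
  then show ?thesis
    unfolding \<nu>_def by (intro iffD1[OF convergent_LIMSEQ_iff] Cauchy_convergent)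
qed

lemma \<nu>_norm_le: "E \<in> sets M \<Longrightarrow> norm (\<nu> E) \<le> B * measure M E"
proof -
  assume E: "E \<in> sets M"
  have "norm (level_measure n E) \<le> B * measure M E" for n
    using level_measure_diff[OF E sets.empty_sets, of n] by simp
  then show ?thesis
    by (intro LIMSEQ_le_const2[OF tendsto_norm[OF level_measure_tendsto[OF E]]]) simp
qed

lemma \<nu>_Un:
  assumes "E \<in> sets M" "F \<in> sets M" "E \<inter> F = {}"
  shows "\<nu> (E \<union> F) = \<nu> E + \<nu> F"
proof (rule LIMSEQ_unique)
  show "(\<lambda>n. level_measure n (E \<union> F)) \<longlonglongrightarrow> \<nu> (E \<union> F)"
    using assms by (intro level_measure_tendsto) auto
  show "(\<lambda>n. level_measure n (E \<union> F)) \<longlonglongrightarrow> \<nu> E + \<nu> F"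
    unfolding level_measure_Un[OF assms] using assms by (intro tendsto_add level_measure_tendsto)
qed

lemma \<nu>_cell:
  assumes p: "p \<in> R n"
  shows "\<nu> (fst p) = measure M (fst p) *\<^sub>R snd p"
proof -
  have "\<forall>\<^sub>F m in sequentially. level_measure m (fst p) = level_measure n (fst p)"
    unfolding eventually_sequentially using level_measure_stable[OF cell_union_cell[OF p]] by blast
  then have "(\<lambda>m. level_measure m (fst p)) \<longlonglongrightarrow> level_measure n (fst p)" by (rule tendsto_eventually)
  then have "\<nu> (fst p) = level_measure n (fst p)"
    using level_measure_tendsto[OF cell_sets[OF p]] LIMSEQ_unique by blast
  also have "\<dots> = (\<Sum>q\<in>R n. if q = p then measure M (fst p) *\<^sub>R snd p else 0)"
    unfolding level_measure_def using cells_disjoint[OF p] by (intro sum.cong) auto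
  also have "\<dots> = measure M (fst p) *\<^sub>R snd p"
    using finite_level p by simp
  finally show ?thesis .
qed

lemma \<nu>_vector_measure: "vector_measure M \<nu>"
  unfolding vector_measure_def
proof (intro allI impI)
  fix A :: "nat \<Rightarrow> 'w set" assume A: "range A \<subseteq> sets M"
    and disj: "disjoint_family A"
  define T where "T k = (\<Union>i\<in>{k..}. A i)" for k
  have As: "A i \<in> sets M" for i using A by blast
  have Ts: "T k \<in> sets M" for k unfolding T_def using As by blast
  have T_step: "T k = A k \<union> T (Suc k)" for k
  proof -
    have "{k..} = insert k {Suc k..}" by auto
    then show ?thesis by (simp add: T_def)
  qed
  have T_disj: "A k \<inter> T (Suc k) = {}" for k
  proof -
    have "A k \<inter> A i = {}" if "Suc k \<le> i" for i
      using disj that by (intro disjoint_family_onD[of A UNIV]) auto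
    then show ?thesis unfolding T_def by blast
  qed
  have split: "\<nu> (\<Union>i. A i) = (\<Sum>i<k. \<nu> (A i)) + \<nu> (T k)" for k
  proof (induction k)
    case 0 then show ?case by (simp add: T_def)
  next
    case (Suc k)
    then show ?case using T_step[of k] \<nu>_Un[OF As Ts T_disj, of k] by simp
  qed
  have split': "measure M (\<Union>i. A i) = (\<Sum>i<k. measure M (A i)) + measure M (T k)" for k
  proof (induction k)
    case 0 then show ?case by (simp add: T_def)
  next
    case (Suc k)
    then show ?case using T_step[of k] finite_measure_Union[OF As Ts T_disj, of k] by simp
  qed
  have "(\<lambda>k. measure M (\<Union>i. A i) - (\<Sum>i<k. measure M (A i))) \<longlonglongrightarrow> measure M (\<Union>i. A i) - measure M (\<Union>i. A i)"
    using finite_measure_UNION[OF A disj] by (intro tendsto_diff) (auto simp: sums_def)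
  moreover have "measure M (\<Union>i. A i) - (\<Sum>i<k. measure M (A i)) = measure M (T k)" for k
    using split'[of k] by simp
  ultimately have "(\<lambda>k. B * measure M (T k)) \<longlonglongrightarrow> 0"
    by (intro tendsto_mult_right_zero) simp
  then have "(\<lambda>k. \<nu> (T k)) \<longlonglongrightarrow> 0"
    by (rule Lim_null_comparison[rotated]) (use \<nu>_norm_le[OF Ts] in auto)
  then have "(\<lambda>k. \<nu> (\<Union>i. A i) - \<nu> (T k)) \<longlonglongrightarrow> \<nu> (\<Union>i. A i) - 0"
    by (intro tendsto_intros)
  moreover have "\<nu> (\<Union>i. A i) - \<nu> (T k) = (\<Sum>i<k. \<nu> (A i))" for k
    using split[of k] by simp
  ultimately show "(\<lambda>i. \<nu> (A i)) sums \<nu> (\<Union>i. A i)" by (simp add: sums_def)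
qed

lemma \<nu>_bounded_variation: "of_bounded_variation M \<nu>"
  unfolding of_bounded_variation_def
proof (intro exI[of _ "B * measure M (space M)"] allI impI)
  fix P assume P: "finite P" "P \<subseteq> sets M" "disjoint P"
  have "(\<Sum>E\<in>P. norm (\<nu> E)) \<le> (\<Sum>E\<in>P. B * measure M E)"
    using P \<nu>_norm_le by (intro sum_mono) auto
  also have "\<dots> = B * measure M (\<Union>E\<in>P. E)"
    using P finite_measure_finite_Union[of P "\<lambda>E. E"]
    by (auto simp: sum_distrib_left[symmetric] disjoint_family_on_def disjoint_def)
  also have "\<dots> \<le> B * measure M (space M)"
    using P by (intro mult_left_mono B_nonneg bounded_measure)
  finally show "(\<Sum>E\<in>P. norm (\<nu> E)) \<le> B * measure M (space M)" .
qed

lemma \<nu>_continuous: "continuous_wrt M \<nu>"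
  unfolding continuous_wrt_def
proof (intro allI impI)
  fix e :: real assume "0 < e"
  have "norm (\<nu> E) < e" if "E \<in> sets M" "measure M E < e / (B + 1)" for E
  proof -
    have "measure M E * (B + 1) < e" using that B_nonneg by (simp add: pos_less_divide_eq)
    moreover have "measure M E * (B + 1) = B * measure M E + measure M E"
      by (simp add: algebra_simps)
    ultimately have "B * measure M E < e" using measure_nonneg[of M E] by linarith
    then show ?thesis using \<nu>_norm_le[OF that(1)] by simp
  qed
  then show "\<exists>d>0. \<forall>E\<in>sets M. measure M E < d \<longrightarrow> norm (\<nu> E) < e"
    using \<open>0 < e\<close> B_nonneg by (intro exI[of _ "e / (B + 1)"]) auto
qed

text \<open>
Otherwise summation over \<open>S\<close> would contradict \<open>less\<close>. This is applied to all cells of a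
level, and then to the children of one of them.\<close>

lemma small_cell:
  assumes S: "S \<subseteq> R n" and h: "h \<in> borel_measurable M"
    and less: "(\<integral>\<^sup>+x\<in>(\<Union>p\<in>S. fst p). h x \<partial>M) < ennreal (c * measure M (\<Union>p\<in>S. fst p))" and c: "0 \<le> c"
  shows "\<exists>p\<in>S. (\<integral>\<^sup>+x\<in>fst p. h x \<partial>M) < ennreal (c * measure M (fst p))"
proof (rule ccontr)
  have fS: "finite S" using S finite_level finite_subset by blast
  have disj: "disjoint_family_on fst S"
    unfolding disjoint_family_on_def using S cells_disjoint by blast
  note [measurable] = h
  have S_sets [measurable]: "p \<in> S \<Longrightarrow> fst p \<in> sets M" for p
    using S cell_sets by blast
  assume "\<not> ?thesis"
  then have "(\<Sum>p\<in>S. ennreal (c * measure M (fst p))) \<le> (\<Sum>p\<in>S. \<integral>\<^sup>+x\<in>fst p. h x \<partial>M)"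
    by (intro sum_mono) (auto simp: not_less)
  also have "\<dots> = (\<integral>\<^sup>+x. (\<Sum>p\<in>S. h x * indicator (fst p) x) \<partial>M)"
    by (rule nn_integral_sum[symmetric]) auto
  also have "\<dots> = (\<integral>\<^sup>+x\<in>(\<Union>p\<in>S. fst p). h x \<partial>M)"
    by (simp add: indicator_UN_disjoint[OF fS disj] sum_distrib_left)
  also have "\<dots> < ennreal (c * measure M (\<Union>p\<in>S. fst p))" by fact
  also have "measure M (\<Union>p\<in>S. fst p) = (\<Sum>p\<in>S. measure M (fst p))"
    using S cell_sets by (intro finite_measure_finite_Union fS disj) blast
  also have "ennreal (c * (\<Sum>p\<in>S. measure M (fst p))) = (\<Sum>p\<in>S. ennreal (c * measure M (fst p)))"
    using c by (subst sum_ennreal) (auto simp: sum_distrib_left)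
  finally show False by simp
qed

text \<open>
A density would be close in mean to a simple function, hence to a step function \<open>t\<close> on the
cells of some level \<open>N\<close>. On some cell \<open>p\<close> of this level and then on some child \<open>q\<close> of \<open>p\<close>,
the mean distance to \<open>t\<close> is still small. But \<open>t\<close> has the same value on \<open>q\<close> as on \<open>p\<close>, and
the averages of the density over \<open>p\<close> and \<open>q\<close> are the values of the martingale there, so
these values are close to each other.\<close>

lemma no_density:
  assumes g: "\<And>E. E \<in> sets M \<Longrightarrow> has_banach_integral M (\<lambda>x. indicator E x *\<^sub>R g x) (\<nu> E)"
  shows False
proof -
  let ?\<Omega> = "space M"
  \<comment> \<open>The two values of the martingale will be within \<open>c\<close> of \<open>t\<close>, hence at distance less than \<open>\<delta>\<close>;
    \<open>\<eta>\<close> is the error allowed in each of the two approximations of the density.\<close>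
  define c where "c = \<delta> / 3"
  define \<eta> where "\<eta> = c * measure M ?\<Omega> / 2"
  have c: "0 < c" and \<eta>: "0 < \<eta>"
    using \<delta>_pos space_pos by (auto simp: c_def \<eta>_def)
  have \<Omega>: "has_banach_integral M (\<lambda>x. indicator ?\<Omega> x *\<^sub>R g x) (\<nu> ?\<Omega>)" by (rule g) simp
  then have "strongly_measurable M (\<lambda>x. indicator ?\<Omega> x *\<^sub>R g x)"
    by (simp add: has_banach_integral_def)
  then obtain f where fg': "AE x in M. f x = indicator ?\<Omega> x *\<^sub>R g x"
    and f: "\<And>t. simple_function M t \<Longrightarrow> (\<lambda>x. norm (f x - t x)) \<in> borel_measurable M"
    using strongly_measurable_representative by blast
  have fg: "AE x in M. f x = g x" using fg' AE_space by eventually_elim simp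
  note deviation = has_banach_integral_deviation[OF finite_measure_axioms _ g fg f]
  have "\<exists>s. simple_function M s \<and> (\<integral>\<^sup>+x. norm (f x - s x) \<partial>M) < ennreal \<eta>"
  proof -
    obtain s where s: "\<And>i::nat. Bochner_Integration.simple_bochner_integrable M (s i)"
      and s0: "(\<lambda>i. \<integral>\<^sup>+x. norm (indicator ?\<Omega> x *\<^sub>R g x - s i x) \<partial>M) \<longlonglongrightarrow> 0"
      using \<Omega> unfolding has_banach_integral_def by blast
    have "\<forall>\<^sub>F i in sequentially. (\<integral>\<^sup>+x. norm (indicator ?\<Omega> x *\<^sub>R g x - s i x) \<partial>M) < ennreal \<eta>"
      using s0 \<eta> by (intro order_tendstoD(2)) auto
    then obtain i where "(\<integral>\<^sup>+x. norm (indicator ?\<Omega> x *\<^sub>R g x - s i x) \<partial>M) < ennreal \<eta>"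
      using eventually_happens' sequentially_bot by blast
    moreover have "(\<integral>\<^sup>+x. norm (indicator ?\<Omega> x *\<^sub>R g x - s i x) \<partial>M) = (\<integral>\<^sup>+x. norm (f x - s i x) \<partial>M)"
      by (rule nn_integral_cong_AE) (use fg' in eventually_elim, simp)
    moreover have "simple_function M (s i)" using s[of i] by cases
    ultimately show ?thesis by auto
  qed
  then obtain s where s: "simple_function M s"
    and fs: "(\<integral>\<^sup>+x. norm (f x - s x) \<partial>M) < ennreal \<eta>" by blast
  define V where "V = s ` ?\<Omega>"
  have fV: "finite V" using s by (simp add: V_def simple_function_def)
  define S where "S v = s -` {v} \<inter> ?\<Omega>" for v
  have S [measurable]: "S v \<in> sets M" for v unfolding S_def using s by (rule simple_functionD)
  \<comment> \<open>The level sets \<open>S v\<close> of \<open>s\<close> are replaced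
    by unions of cells \<open>A v\<close>. The summand \<open>1\<close> keeps the
    denominator positive.\<close>
  define \<tau> where "\<tau> = \<eta> / (1 + (\<Sum>v\<in>V. norm v))"
  have \<tau>: "0 < \<tau>"
    unfolding \<tau>_def using \<eta> by (intro divide_pos_pos add_pos_nonneg sum_nonneg) auto
  obtain m A where A: "A v \<in> cell_unions (m v)"
    and Am: "measure M (sym_diff (S v) (A v)) < \<tau>" for v
    using approx_by_cells[OF S \<tau>] by metis
  define N where "N = Max (insert 0 (m ` V))"
  have AN: "A v \<in> cell_unions N" if "v \<in> V" for v
  proof -
    have "m v \<le> N" unfolding N_def using that fV by (intro Max_ge) auto
    then show ?thesis using A[of v] cell_union_mono by blast
  qed
  have [measurable]: "A v \<in> sets M" for v using A cell_union_sets by blast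
  define t where "t x = (\<Sum>v\<in>V. indicator (A v) x *\<^sub>R v)" for x
  have t: "simple_function M t"
    unfolding t_def
  proof (rule simple_function_sum)
    show "simple_function M (\<lambda>x. indicator (A v) x *\<^sub>R v)" for v
      by (rule simple_function_compose1[of _ "indicator (A v) :: _ \<Rightarrow> real" "\<lambda>r. r *\<^sub>R v"]) auto
  qed
  have s_eq: "s x = (\<Sum>v\<in>V. indicator (S v) x *\<^sub>R v)" if x: "x \<in> ?\<Omega>" for x
  proof -
    have "(\<Sum>v\<in>V. indicator (S v) x *\<^sub>R v) = (\<Sum>v\<in>V. if v = s x then s x else 0)"
      using x by (intro sum.cong) (auto simp: S_def)
    also have "\<dots> = s x" using fV x by (simp add: V_def)
    finally show ?thesis ..
  qed
  let ?h = "\<lambda>x. norm (f x - t x)"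
  have hm [measurable]: "?h \<in> borel_measurable M" by (rule f[OF t])
  have fsm [measurable]: "(\<lambda>x. norm (f x - s x)) \<in> borel_measurable M" by (rule f[OF s])
  have "(\<integral>\<^sup>+x. ?h x \<partial>M) \<le> (\<integral>\<^sup>+x. ennreal (norm (f x - s x)) +
      (\<Sum>v\<in>V. ennreal (norm v) * indicator (sym_diff (S v) (A v)) x) \<partial>M)"
  proof (rule nn_integral_mono)
    fix x assume x: "x \<in> ?\<Omega>"
    have "s x - t x = (\<Sum>v\<in>V. (indicator (S v) x - indicator (A v) x) *\<^sub>R v)"
      unfolding s_eq[OF x] t_def by (simp add: sum_subtractf scaleR_diff_left)
    also have "norm \<dots> \<le> (\<Sum>v\<in>V. norm v * indicator (sym_diff (S v) (A v)) x)"
      by (rule order_trans[OF norm_sum], rule sum_mono) (auto simp: indicator_def)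
    finally have "?h x \<le> norm (f x - s x) + (\<Sum>v\<in>V. norm v * indicator (sym_diff (S v) (A v)) x)"
      using norm_triangle_ineq[of "f x - s x" "s x - t x"] by simp
    then have "ennreal (?h x) \<le> ennreal (norm (f x - s x)) + ennreal (\<Sum>v\<in>V. norm v * indicator (sym_diff (S v) (A v)) x)"
      by (subst ennreal_plus[symmetric]) (auto intro!: ennreal_leI sum_nonneg)
    also have "ennreal (\<Sum>v\<in>V. norm v * indicator (sym_diff (S v) (A v)) x)
        = (\<Sum>v\<in>V. ennreal (norm v) * indicator (sym_diff (S v) (A v)) x)"
      by (subst sum_ennreal[symmetric]) (auto simp: ennreal_mult' ennreal_indicator)
    finally show "ennreal (?h x) \<le> ennreal (norm (f x - s x)) +
      (\<Sum>v\<in>V. ennreal (norm v) * indicator (sym_diff (S v) (A v)) x)" .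
  qed
  also have "\<dots> = (\<integral>\<^sup>+x. norm (f x - s x) \<partial>M) +
      (\<Sum>v\<in>V. \<integral>\<^sup>+x. ennreal (norm v) * indicator (sym_diff (S v) (A v)) x \<partial>M)"
    by (subst nn_integral_add) (auto simp: nn_integral_sum)
  also have "\<dots> < ennreal \<eta> + ennreal \<eta>"
  proof (rule add_strict_mono)
    have "(\<Sum>v\<in>V. \<integral>\<^sup>+x. ennreal (norm v) * indicator (sym_diff (S v) (A v)) x \<partial>M)
        = (\<Sum>v\<in>V. ennreal (norm v * measure M (sym_diff (S v) (A v))))"
      by (intro sum.cong refl, subst nn_integral_cmult_indicator) (auto simp: emeasure_eq_measure ennreal_mult')
    also have "\<dots> = ennreal (\<Sum>v\<in>V. norm v * measure M (sym_diff (S v) (A v)))"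
      by (rule sum_ennreal) auto
    also have "\<dots> < ennreal \<eta>"
    proof (rule ennreal_lessI[OF \<eta>])
      have "(\<Sum>v\<in>V. norm v * measure M (sym_diff (S v) (A v))) \<le> (\<Sum>v\<in>V. norm v * \<tau>)"
        using Am by (intro sum_mono mult_left_mono) (auto intro: less_imp_le)
      also have "\<dots> = (\<Sum>v\<in>V. norm v) * \<tau>" by (simp add: sum_distrib_right)
      also have "\<dots> < (1 + (\<Sum>v\<in>V. norm v)) * \<tau>"
        using \<tau> by (intro mult_strict_right_mono) auto
      also have "\<dots> = \<eta>"
      proof -
        have "0 \<le> (\<Sum>v\<in>V. norm v)" by (intro sum_nonneg) auto
        then show ?thesis by (simp add: \<tau>_def)
      qed
      finally show "(\<Sum>v\<in>V. norm v * measure M (sym_diff (S v) (A v))) < \<eta>" .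
    qed
    finally show "(\<Sum>v\<in>V. \<integral>\<^sup>+x. ennreal (norm v) * indicator (sym_diff (S v) (A v)) x \<partial>M) < ennreal \<eta>" .
  qed (rule fs)
  also have "\<dots> = ennreal (c * measure M ?\<Omega>)"
    using \<eta> by (subst ennreal_plus[symmetric]) (auto simp: \<eta>_def)
  also have "(\<integral>\<^sup>+x. ?h x \<partial>M) = (\<integral>\<^sup>+x\<in>?\<Omega>. ?h x \<partial>M)" by (rule nn_integral_cong) simp
  finally have "(\<integral>\<^sup>+x\<in>(\<Union>p\<in>R N. fst p). ?h x \<partial>M) < ennreal (c * measure M (\<Union>p\<in>R N. fst p))"
    by (simp add: cells_cover)
  then obtain p where p: "p \<in> R N"
    and hp: "(\<integral>\<^sup>+x\<in>fst p. ?h x \<partial>M) < ennreal (c * measure M (fst p))"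
    using small_cell[OF order_refl, of "\<lambda>x. ennreal (?h x)" N c] c by auto
  have "children N p \<subseteq> R (Suc N)" by (auto simp: children_def)
  then have "\<exists>q\<in>children N p. (\<integral>\<^sup>+x\<in>fst q. ?h x \<partial>M) < ennreal (c * measure M (fst q))"
    using c hp by (intro small_cell) (simp_all flip: cell_eq_Union_children[OF p])
  then obtain q where q: "q \<in> children N p"
    and hq: "(\<integral>\<^sup>+x\<in>fst q. ?h x \<partial>M) < ennreal (c * measure M (fst q))"
      by blast
  obtain w where w: "\<And>x. x \<in> fst p \<Longrightarrow> t x = w"
  proof
    fix x assume x: "x \<in> fst p"
    have "indicator (A v) x = (if fst p \<subseteq> A v then 1 else 0 :: real)" if "v \<in> V" for v
    proof -
      have "fst p \<subseteq> A v \<or> fst p \<inter> A v = {}"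
        using AN[OF that] p unfolding cell_unions_def by blast
      then show ?thesis using x by (auto simp: indicator_def)
    qed
    then show "t x = (\<Sum>v\<in>V. (if fst p \<subseteq> A v then 1 else 0 :: real) *\<^sub>R v)"
      unfolding t_def by (intro sum.cong) auto
  qed
  have near: "norm (snd r - w) < c"
    if r: "r \<in> R k" "fst r \<subseteq> fst p" "(\<integral>\<^sup>+x\<in>fst r. ?h x \<partial>M) < ennreal (c * measure M (fst r))" for r k
  proof -
    let ?\<mu> = "measure M (fst r)"
    have "ennreal (norm (\<nu> (fst r) - ?\<mu> *\<^sub>R w)) \<le> (\<integral>\<^sup>+x\<in>fst r. norm (f x - w) \<partial>M)"
      by (intro deviation cell_sets[OF r(1)])
    also have "\<dots> = (\<integral>\<^sup>+x\<in>fst r. ?h x \<partial>M)"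
      using w r(2) by (intro nn_integral_cong) (auto simp: indicator_def)
    also have "\<dots> < ennreal (c * ?\<mu>)" by (rule r(3))
    finally have "norm (\<nu> (fst r) - ?\<mu> *\<^sub>R w) < c * ?\<mu>"
      by (subst (asm) ennreal_less_iff) auto
    moreover have "\<nu> (fst r) - ?\<mu> *\<^sub>R w = ?\<mu> *\<^sub>R (snd r - w)"
      using \<nu>_cell[OF r(1)] by (simp add: scaleR_diff_right)
    ultimately have "?\<mu> * norm (snd r - w) < ?\<mu> * c" by (simp add: mult.commute)
    then show ?thesis using cell_pos[OF r(1)] by (simp add: mult_less_cancel_left_pos)
  qed
  have q': "q \<in> R (Suc N)" "fst q \<subseteq> fst p" using q by (auto simp: children_def)
  have "norm (snd q - w) < c" "norm (snd p - w) < c"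
    using near[OF q' hq] near[OF p order_refl hp] by auto
  moreover have "\<delta> \<le> norm ((snd q - w) - (snd p - w))" using separated[OF p q'] by simp
  moreover have "norm ((snd q - w) - (snd p - w)) \<le> norm (snd q - w) + norm (snd p - w)"
    by (rule norm_triangle_ineq4)
  ultimately show False using \<delta>_pos by (simp add: c_def)
qed

lemma not_radon_nikodym: "\<not> radon_nikodym_wrt M TYPE('a)"
  unfolding radon_nikodym_wrt_def
  using \<nu>_vector_measure \<nu>_bounded_variation \<nu>_continuous no_density by blast

end

section \<open>Convex hulls and the Radon--Nikodym property\<close>

lemma split_interval:
  fixes u :: "'b \<Rightarrow> real"
  assumes "finite S" "\<And>s. s \<in> S \<Longrightarrow> 0 < u s"
  shows "\<exists>p. (\<Union>s\<in>S. {p s..<p s + u s}) = {a..<a + sum u S} \<and>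
             disjoint_family_on (\<lambda>s. {p s..<p s + u s}) S"
  using assms
proof (induction S arbitrary: a rule: finite_induct)
  case empty
  then show ?case by (auto simp: disjoint_family_on_def)
next
  case (insert v S)
  have v: "0 < u v" using insert.prems by simp
  have v': "0 \<le> sum u S" by (intro sum_nonneg less_imp_le insert.prems) simp
  obtain p where p: "(\<Union>s\<in>S. {p s..<p s + u s}) = {a + u v..<a + u v + sum u S}"
    "disjoint_family_on (\<lambda>s. {p s..<p s + u s}) S"
    using insert.IH[of "a + u v"] insert.prems by auto
  define p' where "p' = p(v := a)"
  have p'_S: "{p' s..<p' s + u s} = {p s..<p s + u s}" if "s \<in> S" for s
    using that insert.hyps by (auto simp: p'_def)
  then have U: "(\<Union>s\<in>S. {p' s..<p' s + u s}) = {a + u v..<a + u v + sum u S}"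
    using p(1) by simp
  have "(\<Union>s\<in>insert v S. {p' s..<p' s + u s}) = {a..<a + u v} \<union> {a + u v..<a + u v + sum u S}"
    unfolding U[symmetric] by (simp add: p'_def)
  also have "\<dots> = {a..<a + sum u (insert v S)}"
    using v v' insert.hyps by (auto simp: ivl_disj_un)
  finally have 1: "(\<Union>s\<in>insert v S. {p' s..<p' s + u s}) = {a..<a + sum u (insert v S)}" .
  have "{p' v..<p' v + u v} \<inter> (\<Union>s\<in>S. {p' s..<p' s + u s}) = {}"
    unfolding U by (auto simp: p'_def)
  moreover have "disjoint_family_on (\<lambda>s. {p' s..<p' s + u s}) S"
    using p(2) p'_S by (auto simp: disjoint_family_on_def)
  ultimately have "disjoint_family_on (\<lambda>s. {p' s..<p' s + u s}) (insert v S)"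
    using insert.hyps by (subst disjoint_family_on_insert) auto
  then show ?case using 1 by blast
qed

text \<open>
If \<open>norm z < 1/2\<close>, then \<open>z\<close> is the midpoint of two points at distance \<open>1/2\<close> from it.
Otherwise let \<open>n = norm z\<close> and \<open>x = z / n\<close>, and approximate \<open>0\<close> by a convex combination \<open>e\<close>
of vectors \<open>y\<close> of norm at least \<open>1\<close> for which \<open>norm (x + y)\<close> is hardly larger than \<open>1\<close>. Then
\<open>z\<close> is exactly the same convex combination of the points \<open>z + n (y - e) = n (x + y - e)\<close>.
These are far from \<open>z\<close>, and their norm is hardly larger than \<open>n\<close>.\<close>

lemma spread_decomposition:
  fixes Y :: "'a::real_normed_vector set"
  assumes Y: "subspace Y" and w: "w \<in> Y" "norm w = 1"
    and near0: "\<And>x \<eta>. x \<in> Y \<Longrightarrow> norm x = 1 \<Longrightarrow> 0 < \<eta> \<Longrightarrow>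
      0 \<in> closure (convex hull {y \<in> Y. 1 \<le> norm y \<and> norm (x + y) < 1 + \<eta>})"
    and z: "z \<in> Y" and \<eta>: "0 < \<eta>"
  obtains S u where "finite S" "S \<subseteq> Y" "\<And>s. s \<in> S \<Longrightarrow> 0 < u s" "sum u S = 1"
    "(\<Sum>s\<in>S. u s *\<^sub>R s) = z" "\<And>s. s \<in> S \<Longrightarrow> 1/4 \<le> norm (s - z)"
    "\<And>s. s \<in> S \<Longrightarrow> norm s \<le> max 1 (norm z + \<eta>)"
proof (cases "norm z < 1/2")
  case True
  let ?h = "(1/2) *\<^sub>R w"
  have ne: "z + ?h \<noteq> z - ?h" using w by (auto simp: algebra_simps simp flip: scaleR_add_left)
  show ?thesis
  proof (rule that[of "{z + ?h, z - ?h}" "\<lambda>_. 1/2"])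
    show "{z + ?h, z - ?h} \<subseteq> Y"
      using Y z w by (auto intro: subspace_add subspace_diff subspace_scale)
    show "(\<Sum>s\<in>{z + ?h, z - ?h}. (1/2) *\<^sub>R s) = z"
      using ne by (simp add: algebra_simps flip: scaleR_add_left)
    show "norm s \<le> max 1 (norm z + \<eta>)" if "s \<in> {z + ?h, z - ?h}" for s
      using that True norm_triangle_ineq[of z ?h] norm_triangle_ineq4[of z ?h] w by auto
  qed (use ne w in auto)
next
  case False
  define n where "n = norm z"
  have n: "1/2 \<le> n" "0 < n" using False by (auto simp: n_def)
  define x where "x = (1/n) *\<^sub>R z"
  have x: "x \<in> Y" "norm x = 1" "n *\<^sub>R x = z"
    using Y z n by (auto simp: x_def subspace_scale n_def)
  define \<rho> where "\<rho> = min (1/2) (\<eta> / (2 * n))"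
  have \<rho>: "0 < \<rho>" "\<rho> \<le> 1/2" "n * \<rho> \<le> \<eta> / 2"
    using \<eta> n by (auto simp: \<rho>_def min_def field_simps)
  let ?C = "{y \<in> Y. 1 \<le> norm y \<and> norm (x + y) < 1 + \<rho>}"
  obtain e where e: "e \<in> convex hull ?C" "norm e < \<rho>"
    using near0[OF x(1,2) \<rho>(1)] \<rho>(1) unfolding closure_approachable by auto
  obtain T v where T: "finite T" "T \<subseteq> ?C" "\<And>y. y \<in> T \<Longrightarrow> 0 \<le> v y" "sum v T = 1" "(\<Sum>y\<in>T. v y *\<^sub>R y) = e"
    using e(1) unfolding convex_hull_explicit by blast
  have "convex hull ?C \<subseteq> Y"
    using subspace_imp_convex[OF Y] by (intro hull_minimal) auto
  then have eY: "e \<in> Y" using e by blast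
  define g where "g y = z + n *\<^sub>R (y - e)" for y
  have inj: "inj_on g A" for A using n by (auto simp: inj_on_def g_def)
  define T' where "T' = {y \<in> T. 0 < v y}"
  have T': "finite T'" "T' \<subseteq> ?C" using T by (auto simp: T'_def)
  have v1: "sum v T' = 1" and ve: "(\<Sum>y\<in>T'. v y *\<^sub>R y) = e"
    unfolding T(4,5)[symmetric] T'_def
    by (intro sum.mono_neutral_left; use T(1,3) in \<open>force simp: less_le\<close>)+
  define u where "u = v \<circ> inv_into T' g"
  have u: "u (g y) = v y" if "y \<in> T'" for y
    using that inj by (simp add: u_def)
  show ?thesis
  proof (rule that[of "g ` T'" u])
    show "finite (g ` T')" using T' by simp
    show "g ` T' \<subseteq> Y"
      using T' eY z Y by (auto simp: g_def intro!: subspace_add subspace_scale subspace_diff)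
    show "0 < u s" if "s \<in> g ` T'" for s using that u by (auto simp: T'_def)
    show "sum u (g ` T') = 1" using u v1 by (simp add: sum.reindex[OF inj])
    have "(\<Sum>s\<in>g ` T'. u s *\<^sub>R s) = (\<Sum>y\<in>T'. v y *\<^sub>R g y)"
      using u by (simp add: sum.reindex[OF inj])
    also have "\<dots> = (\<Sum>y\<in>T'. v y *\<^sub>R (z + n *\<^sub>R (y - e)))"
      by (simp add: g_def)
    also have "\<dots> = sum v T' *\<^sub>R z + n *\<^sub>R ((\<Sum>y\<in>T'. v y *\<^sub>R y) - sum v T' *\<^sub>R e)"
      by (simp add: scaleR_sum_left sum.distrib sum_subtractf scaleR_sum_right algebra_simps)
    also have "\<dots> = z" using v1 ve by simp
    finally show "(\<Sum>s\<in>g ` T'. u s *\<^sub>R s) = z" .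
    show "1/4 \<le> norm (s - z)" if s: "s \<in> g ` T'" for s
    proof -
      obtain y where y: "y \<in> T'" "s = g y" using s by blast
      have "norm y - norm e \<le> norm (y - e)" by (rule norm_triangle_ineq2)
      then have "1/2 \<le> norm (y - e)" using y T' e(2) \<rho>(2) by auto
      then have "(1/2) * (1/2) \<le> n * norm (y - e)" using n by (intro mult_mono) auto
      then show ?thesis using n by (simp add: y g_def)
    qed
    show "norm s \<le> max 1 (norm z + \<eta>)" if s: "s \<in> g ` T'" for s
    proof -
      obtain y where y: "y \<in> T'" "s = g y" using s by blast
      have "s = n *\<^sub>R ((x + y) - e)" using x(3) by (simp add: y g_def algebra_simps)
      then have "norm s = n * norm ((x + y) - e)" using n by simp
      also have "\<dots> \<le> n * ((1 + \<rho>) + \<rho>)"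
        using norm_triangle_ineq4[of "x + y" e] y T' e(2) n by (intro mult_left_mono) auto
      also have "\<dots> \<le> n + \<eta>" using \<rho>(3) by (simp add: algebra_simps)
      finally show ?thesis by (simp add: n_def)
    qed
  qed
qed

text \<open>
The bound \<open>2 - 1 / 2 ^ n\<close> leaves room for an increase by \<open>1 / 2 ^ Suc n\<close> at each level, and
still keeps the whole martingale below \<open>2\<close>.\<close>

definition valued_interval :: "'a::real_normed_vector set \<Rightarrow> nat \<Rightarrow> real set \<times> 'a \<Rightarrow> bool" where
  "valued_interval Y n p \<longleftrightarrow> (\<exists>a b. a < b \<and> fst p = {a..<b}) \<and> snd p \<in> Y \<and> norm (snd p) \<le> 2 - 1 / 2 ^ n"

definition splits :: "'a::real_normed_vector set \<Rightarrow> nat \<Rightarrow> real set \<times> 'a \<Rightarrow> (real set \<times> 'a) set \<Rightarrow> bool" where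
  "splits Y n p D \<longleftrightarrow> finite D \<and> (\<Union>q\<in>D. fst q) = fst p \<and> (\<forall>q\<in>D. \<forall>q'\<in>D. q \<noteq> q' \<longrightarrow> fst q \<inter> fst q' = {}) \<and>
     (\<forall>q\<in>D. valued_interval Y (Suc n) q \<and> 1/4 \<le> norm (snd q - snd p)) \<and>
     (\<Sum>q\<in>D. measure lborel (fst q) *\<^sub>R snd q) = measure lborel (fst p) *\<^sub>R snd p"

text \<open>
The interval is divided in the proportions of the coefficients of a convex combination as in
\<open>spread_decomposition\<close>.\<close>

lemma ex_splits:
  fixes Y :: "'a::real_normed_vector set"
  assumes Y: "subspace Y" and w: "w \<in> Y" "norm w = 1"
    and near0: "\<And>x \<eta>. x \<in> Y \<Longrightarrow> norm x = 1 \<Longrightarrow> 0 < \<eta> \<Longrightarrow>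
      0 \<in> closure (convex hull {y \<in> Y. 1 \<le> norm y \<and> norm (x + y) < 1 + \<eta>})"
    and p: "valued_interval Y n p"
  shows "\<exists>D. splits Y n p D"
proof -
  obtain a b where ab: "a < b" "fst p = {a..<b}"
    and z: "snd p \<in> Y" "norm (snd p) \<le> 2 - 1 / 2 ^ n"
    using p unfolding valued_interval_def by blast
  let ?z = "snd p" and ?\<eta> = "1 / 2 ^ Suc n :: real"
  obtain S u where S: "finite S" "S \<subseteq> Y"
    and u: "\<And>s. s \<in> S \<Longrightarrow> 0 < u s" "sum u S = 1"
    and mean: "(\<Sum>s\<in>S. u s *\<^sub>R s) = ?z"
      and far: "\<And>s. s \<in> S \<Longrightarrow> 1/4 \<le> norm (s - ?z)"
    and small: "\<And>s. s \<in> S \<Longrightarrow> norm s \<le> max 1 (norm ?z + ?\<eta>)"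
    using spread_decomposition[OF Y w near0 z(1), of ?\<eta>] by auto
  define l where "l s = (b - a) * u s" for s
  have l: "0 < l s" if "s \<in> S" for s using u that ab by (simp add: l_def)
  have suml: "sum l S = b - a" using u(2) by (simp add: l_def flip: sum_distrib_left)
  obtain c where c: "(\<Union>s\<in>S. {c s..<c s + l s}) = {a..<b}"
      and disj: "disjoint_family_on (\<lambda>s. {c s..<c s + l s}) S"
    using split_interval[where u = l and S = S and a = a, OF S(1)] l suml by auto
  define f where "f s = ({c s..<c s + l s}, s)" for s
  have inj: "inj_on f S" by (auto simp: inj_on_def f_def)
  have norm_s: "norm s \<le> 2 - 1 / 2 ^ Suc n" if "s \<in> S" for s
  proof -
    have "(1::real) \<le> 2 ^ Suc n" by (rule one_le_power) simp
    then have "1 / 2 ^ Suc n \<le> (1::real)" by simp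
    moreover have "2 - 1 / 2 ^ n + 1 / 2 ^ Suc n = (2 - 1 / 2 ^ Suc n :: real)"
      by (simp add: field_simps)
    ultimately show ?thesis using small[OF that] z(2) by linarith
  qed
  have "splits Y n p (f ` S)"
    unfolding splits_def
  proof (intro conjI ballI impI)
    show "finite (f ` S)" using S by simp
    show "(\<Union>q\<in>f ` S. fst q) = fst p" using c ab by (simp add: f_def)
    show "fst q \<inter> fst q' = {}" if "q \<in> f ` S" "q' \<in> f ` S" "q \<noteq> q'" for q q'
    proof -
      obtain s s' where "s \<in> S" "q = f s" "s' \<in> S" "q' = f s'" "s \<noteq> s'"
        using \<open>q \<in> f ` S\<close> \<open>q' \<in> f ` S\<close> \<open>q \<noteq> q'\<close> by blast
      then show ?thesis using disjoint_family_onD[OF disj, of s s'] by (simp add: f_def)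
    qed
    show "valued_interval Y (Suc n) q" if "q \<in> f ` S" for q
    proof -
      obtain s where s: "s \<in> S" "q = f s" using \<open>q \<in> f ` S\<close> by blast
      then have "c s < c s + l s" "fst q = {c s..<c s + l s}" "snd q \<in> Y" "norm (snd q) \<le> 2 - 1 / 2 ^ Suc n"
        using l S norm_s by (auto simp: f_def)
      then show ?thesis unfolding valued_interval_def by blast
    qed
    show "1/4 \<le> norm (snd q - snd p)" if "q \<in> f ` S" for q
      using that far by (auto simp: f_def)
    have "(\<Sum>q\<in>f ` S. measure lborel (fst q) *\<^sub>R snd q) = (\<Sum>s\<in>S. l s *\<^sub>R s)"
      unfolding sum.reindex[OF inj] using l by (intro sum.cong) (auto simp: f_def less_imp_le)
    also have "\<dots> = (b - a) *\<^sub>R ?z" by (simp add: l_def scaleR_sum_right flip: mean)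
    also have "b - a = measure lborel (fst p)" using ab by simp
    finally show "(\<Sum>q\<in>f ` S. measure lborel (fst q) *\<^sub>R snd q) = measure lborel (fst p) *\<^sub>R snd p" .
  qed
  then show ?thesis by blast
qed

text \<open>
This is a substitute for the existence of slices of small diameter in the unit ball of \<open>Y\<close>.
If it failed, then repeated splitting would produce a bounded martingale on \<open>{0..<1}\<close> with
separated values, starting with the value \<open>0\<close>. Its cells need not generate all Borel sets,
so Lebesgue measure is restricted to the sigma-algebra that they generate.\<close>

lemma rnp_convex_hull_avoids_zero:
  fixes Y :: "'a::banach set"
  assumes rnp: "radon_nikodym_property TYPE('a)" and Y: "subspace Y"
    and w: "w \<in> Y" "w \<noteq> 0"
  obtains x \<eta> where "x \<in> Y" "norm x = 1" "0 < \<eta>"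
    "0 \<notin> closure (convex hull {y \<in> Y. 1 \<le> norm y \<and> norm (x + y) < 1 + \<eta>})"
proof (rule ccontr)
  assume "\<not> thesis"
  then have near0: "\<And>x \<eta>. x \<in> Y \<Longrightarrow> norm x = 1 \<Longrightarrow> 0 < \<eta> \<Longrightarrow>
      0 \<in> closure (convex hull {y \<in> Y. 1 \<le> norm y \<and> norm (x + y) < 1 + \<eta>})"
    using that by blast
  have w': "(1 / norm w) *\<^sub>R w \<in> Y" "norm ((1 / norm w) *\<^sub>R w) = 1"
    using w Y by (auto simp: subspace_scale)
  have "\<exists>D. valued_interval Y n p \<longrightarrow> splits Y n p D" for n p
    using ex_splits[OF Y w' near0] by blast
  then obtain D where D: "valued_interval Y n p \<Longrightarrow> splits Y n p (D n p)" for n p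
    by metis
  define R where "R = rec_nat {({0..<1::real}, 0::'a)} (\<lambda>n S. \<Union>p\<in>S. D n p)"
  have R0: "R 0 = {({0..<1}, 0)}" and RS: "R (Suc n) = (\<Union>p\<in>R n. D n p)" for n
    by (simp_all add: R_def)
  have good: "\<forall>p\<in>R n. valued_interval Y n p" for n
  proof (induction n)
    case 0
    have "valued_interval Y 0 ({0..<1}, 0)"
      unfolding valued_interval_def using subspace_0[OF Y]
      by (intro conjI exI[of _ "0::real"] exI[of _ "1::real"]) auto
    then show ?case by (simp add: R0)
  next
    case (Suc n)
    then show ?case using D unfolding RS splits_def by blast
  qed
  have split: "splits Y n p (D n p)" if "p \<in> R n" for n p using good that D by blast
  have fin: "finite (R n)" for n
  proof (induction n)
    case (Suc n)
    then show ?case using split unfolding RS splits_def by blast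
  qed (simp add: R0)
  have sub: "fst q \<subseteq> fst p" if "p \<in> R n" "q \<in> D n p" for n p q
    using split[OF that(1)] that(2) unfolding splits_def by blast
  have disj: "\<forall>p\<in>R n. \<forall>q\<in>R n. p \<noteq> q \<longrightarrow> fst p \<inter> fst q = {}" for n
  proof (induction n)
    case (Suc n)
    show ?case
    proof (intro ballI impI)
      fix p q assume pq: "p \<in> R (Suc n)" "q \<in> R (Suc n)" "p \<noteq> q"
      obtain p' q' where p': "p' \<in> R n" "p \<in> D n p'" and q': "q' \<in> R n" "q \<in> D n q'"
        using pq unfolding RS by blast
      show "fst p \<inter> fst q = {}"
      proof (cases "p' = q'")
        case True
        then show ?thesis using split[OF p'(1)] p' q' pq unfolding splits_def by blast
      next
        case False
        then have "fst p' \<inter> fst q' = {}" using Suc p' q' by blast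
        then show ?thesis using sub[OF p'] sub[OF q'] by blast
      qed
    qed
  qed (simp add: R0)
  have cover: "(\<Union>p\<in>R n. fst p) = {0..<1}" for n
  proof (induction n)
    case (Suc n)
    have "(\<Union>q\<in>R (Suc n). fst q) = (\<Union>p\<in>R n. \<Union>q\<in>D n p. fst q)"
      unfolding RS by blast
    also have "\<dots> = (\<Union>p\<in>R n. fst p)"
      using split by (intro SUP_cong) (auto simp: splits_def)
    finally show ?case using Suc by simp
  qed (simp add: R0)
  define \<A> where "\<A> = (\<Union>n. fst ` R n)"
  define M where "M = distr (restrict_space lborel {0..<1::real}) (sigma {0..<1} \<A>) (\<lambda>x. x)"
  have interval: "\<exists>a b. a < b \<and> fst p = {a..<b}" if "p \<in> R n" for p n
    using good that unfolding valued_interval_def by blast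
  have \<A>: "\<A> \<subseteq> Pow {0..<1}" "\<A> \<subseteq> sets borel"
    using cover interval unfolding \<A>_def by (blast, force)
  have meas: "(\<lambda>x. x) \<in> restrict_space lborel {0..<1} \<rightarrow>\<^sub>M sigma {0..<1::real} \<A>"
  proof (rule measurable_sigma_sets[of _ "{0..<1}" \<A>])
    show "sets (sigma {0..<1} \<A>) = sigma_sets {0..<1} \<A>" using \<A> by simp
    show "(\<lambda>x. x) -` A \<inter> space (restrict_space lborel {0..<1}) \<in> sets (restrict_space lborel {0..<1})"
      if "A \<in> \<A>" for A
      using that \<A> by (auto simp: sets_restrict_space space_restrict_space)
  qed (use \<A> in \<open>auto simp: space_restrict_space\<close>)
  have space_M: "space M = {0..<1}" and sets_M: "sets M = sigma_sets {0..<1} \<A>"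
    using \<A> by (simp_all add: M_def)
  have measure_M: "measure M E = measure lborel E" if E: "E \<in> sets M" for E
  proof -
    have E1: "E \<subseteq> {0..<1}" using E space_M sets.sets_into_space by blast
    have "measure M E = measure (restrict_space lborel {0..<1}) ((\<lambda>x. x) -` E \<inter> space (restrict_space lborel {0..<1}))"
      unfolding M_def using E by (intro measure_distr meas) (simp add: M_def)
    also have "(\<lambda>x. x) -` E \<inter> space (restrict_space lborel {0..<1}) = E"
      using E1 by (auto simp: space_restrict_space)
    also have "measure (restrict_space lborel {0..<1}) E = measure lborel E"
      using E1 by (intro measure_restrict_space) auto
    finally show ?thesis .
  qed
  have cell: "fst p \<in> sets M" if "p \<in> R n" for p n
    unfolding sets_M \<A>_def using that by (intro sigma_sets.Basic) blast
  have pos: "0 < measure lborel (fst p)" if "p \<in> R n" for p n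
    using interval[OF that] by auto
  have children: "{q. q \<in> R (Suc n) \<and> fst q \<subseteq> fst p} = D n p" if p: "p \<in> R n"
    for n p
  proof (intro equalityI subsetI)
    fix q assume "q \<in> {q. q \<in> R (Suc n) \<and> fst q \<subseteq> fst p}"
    then obtain p' where p': "p' \<in> R n" "q \<in> D n p'"
      and q: "q \<in> R (Suc n)" "fst q \<subseteq> fst p"
      unfolding RS by blast
    have "fst q \<noteq> {}" using pos[OF q(1)] by (cases "fst q = {}") auto
    then have "fst p \<inter> fst p' \<noteq> {}" using q sub[OF p'] by blast
    then have "p = p'" using disj p p'(1) by metis
    then show "q \<in> D n p" using p' by simp
  next
    fix q assume "q \<in> D n p"
    then show "q \<in> {q. q \<in> R (Suc n) \<and> fst q \<subseteq> fst p}"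
      using p sub unfolding RS by blast
  qed
  have "finite_measure M"
    unfolding M_def
    by (rule finite_measure.finite_measure_distr[OF _ meas])
       (rule finite_measureI, simp add: emeasure_restrict_space space_restrict_space)
  moreover have "separated_martingale M R 2 (1/4)"
  proof (intro separated_martingale.intro separated_martingale_axioms.intro)
    show "finite_measure M" by fact
    fix n p assume p: "p \<in> R n"
    show "fst p \<in> sets M" using cell p .
    show "0 < measure M (fst p)" using pos[OF p] measure_M[OF cell[OF p]] by simp
    show "norm (snd p) \<le> 2"
    proof -
      have "norm (snd p) \<le> 2 - 1 / 2 ^ n" using good p by (auto simp: valued_interval_def)
      also have "\<dots> \<le> 2" by simp
      finally show ?thesis .
    qed
    show "(\<Sum>q | q \<in> R (Suc n) \<and> fst q \<subseteq> fst p. measure M (fst q) *\<^sub>R snd q) = measure M (fst p) *\<^sub>R snd p"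
    proof -
      have "fst q \<in> sets M" if "q \<in> D n p" for q
        using cell[of q "Suc n"] that p unfolding RS by blast
      then have "(\<Sum>q\<in>D n p. measure M (fst q) *\<^sub>R snd q) = (\<Sum>q\<in>D n p. measure lborel (fst q) *\<^sub>R snd q)"
        using measure_M by (intro sum.cong refl) auto
      then show ?thesis
        unfolding children[OF p]
          using split[OF p] measure_M[OF cell[OF p]] by (simp add: splits_def)
    qed
    show "1/4 \<le> norm (snd q - snd p)" if "q \<in> R (Suc n)" "fst q \<subseteq> fst p" for q
      using children[OF p] that split[OF p] by (auto simp: splits_def)
  next
    show "\<exists>p\<in>R n. fst q \<subseteq> fst p" if "q \<in> R (Suc n)" for n q
      using that sub unfolding RS by blast
    show "0 < measure M (space M)" using measure_M[OF sets.top] by (simp add: space_M)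
  qed (use fin disj cover in \<open>auto simp: space_M sets_M \<A>_def\<close>)
  then have "\<not> radon_nikodym_wrt M TYPE('a)" by (rule separated_martingale.not_radon_nikodym)
  ultimately show False using rnp unfolding radon_nikodym_property_def by blast
qed

section \<open>Scalars and continuous functionals\<close>

text \<open>
An isometric embedding fixes the real scalars, because a real number \<open>r\<close> is the only complex
number at distance \<open>\<bar>r\<bar>\<close> from \<open>0\<close> and at distance \<open>\<bar>r - 1\<bar>\<close> from \<open>1\<close>.\<close>

lemma real_or_complex_embedding:
  obtains \<psi> :: "'k::real_or_complex \<Rightarrow> complex"
  where "\<And>x y. \<psi> (x + y) = \<psi> x + \<psi> y" "\<And>x y. \<psi> (x * y) = \<psi> x * \<psi> y" "inj \<psi>"
    "\<And>r. \<psi> (of_real r) = of_real r" "range \<psi> = range of_real \<or> range \<psi> = UNIV"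
proof -
  have "\<exists>\<psi> :: 'k \<Rightarrow> complex. (\<forall>x y. \<psi> (x + y) = \<psi> x + \<psi> y) \<and> (\<forall>x y. \<psi> (x * y) = \<psi> x * \<psi> y) \<and>
      (\<forall>x. norm (\<psi> x) = norm x) \<and> inj \<psi> \<and> (range \<psi> = range of_real \<or> range \<psi> = UNIV)"
    using real_or_complex[where 'a = 'k]
  proof
    assume "\<exists>\<phi> :: 'k \<Rightarrow> real. bij \<phi> \<and> (\<forall>x y. \<phi> (x + y) = \<phi> x + \<phi> y) \<and>
       (\<forall>x y. \<phi> (x * y) = \<phi> x * \<phi> y) \<and> (\<forall>x. norm (\<phi> x) = norm x)"
    then obtain \<phi> :: "'k \<Rightarrow> real" where \<phi>: "bij \<phi>" "\<forall>x y. \<phi> (x + y) = \<phi> x + \<phi> y"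
      "\<forall>x y. \<phi> (x * y) = \<phi> x * \<phi> y" "\<forall>x. norm (\<phi> x) = norm x"
        by blast
    have "range (\<lambda>x. complex_of_real (\<phi> x)) = range of_real"
      using bij_is_surj[OF \<phi>(1)] by (metis image_image)
    then show ?thesis using \<phi>(2-4) bij_is_inj[OF \<phi>(1)]
      by (intro exI[of _ "\<lambda>x. of_real (\<phi> x)"]) (auto simp: inj_def)
  next
    assume "\<exists>\<phi> :: 'k \<Rightarrow> complex. bij \<phi> \<and> (\<forall>x y. \<phi> (x + y) = \<phi> x + \<phi> y) \<and>
       (\<forall>x y. \<phi> (x * y) = \<phi> x * \<phi> y) \<and> (\<forall>x. norm (\<phi> x) = norm x)"
    then show ?thesis using bij_is_inj bij_is_surj by blast
  qed
  then obtain \<psi> :: "'k \<Rightarrow> complex" where add: "\<And>x y. \<psi> (x + y) = \<psi> x + \<psi> y"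
    and mult: "\<And>x y. \<psi> (x * y) = \<psi> x * \<psi> y"
      and norm: "\<And>x. norm (\<psi> x) = norm x"
    and inj: "inj \<psi>" and range: "range \<psi> = range of_real \<or> range \<psi> = UNIV"
      by blast
  have one: "\<psi> 1 = 1"
  proof -
    have "\<psi> 1 * \<psi> 1 = \<psi> 1" using mult[of 1 1] by simp
    moreover have "\<psi> 1 \<noteq> 0" using norm[of 1] by auto
    ultimately show ?thesis by simp
  qed
  have "\<psi> (of_real r) = of_real r" for r
  proof -
    let ?w = "\<psi> (of_real r)"
    have "norm ?w = \<bar>r\<bar>" using norm[of "of_real r"] by simp
    then have 1: "(Re ?w)\<^sup>2 + (Im ?w)\<^sup>2 = r\<^sup>2" by (metis cmod_power2 power2_abs)
    have "\<psi> (of_real r) = \<psi> (of_real r - 1) + \<psi> 1" by (simp flip: add)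
    then have "?w - 1 = \<psi> (of_real (r - 1))" using one by simp
    then have "norm (?w - 1) = \<bar>r - 1\<bar>"
      using norm[of "of_real (r - 1)"] norm_of_real by metis
    then have "(Re (?w - 1))\<^sup>2 + (Im (?w - 1))\<^sup>2 = (r - 1)\<^sup>2"
      by (metis cmod_power2 power2_abs)
    then have 2: "(Re ?w - 1)\<^sup>2 + (Im ?w)\<^sup>2 = (r - 1)\<^sup>2" by simp
    have re: "Re ?w = r" using 1 2 by (simp add: power2_eq_square algebra_simps)
    then have "Im ?w = 0" using 1 by simp
    then show ?thesis using re by (simp add: complex_eq_iff)
  qed
  then show ?thesis using add mult inj range that by blast
qed

text \<open>
The element \<open>j\<close> is \<open>0\<close> in the real case and the imaginary unit in the complex case. This
lets the arguments below treat both cases at once.\<close>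

lemma real_or_complex_coordinates:
  obtains j :: "'k::real_or_complex"
  where "j = 0 \<or> j * j = -1" "\<And>c. \<exists>a b. c = of_real a + of_real b * j"
proof -
  obtain \<psi> :: "'k \<Rightarrow> complex" where \<psi>: "\<And>x y. \<psi> (x + y) = \<psi> x + \<psi> y" "\<And>x y. \<psi> (x * y) = \<psi> x * \<psi> y"
    and inj: "inj \<psi>" and real: "\<And>r. \<psi> (of_real r) = of_real r"
    and range: "range \<psi> = range of_real \<or> range \<psi> = UNIV"
    by (rule real_or_complex_embedding) blast
  from range show ?thesis
  proof
    assume r: "range \<psi> = range of_real"
    show ?thesis
    proof (rule that[of 0])
      fix c
      obtain a where "\<psi> c = of_real a" using r by (metis rangeE rangeI)
      then have "c = of_real a" using real inj by (metis injD)
      then show "\<exists>a b. c = of_real a + of_real b * 0" by auto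
    qed simp
  next
    assume "range \<psi> = UNIV"
    then obtain j where j: "\<psi> j = \<i>" by (metis rangeE UNIV_I)
    show ?thesis
    proof (rule that[of j])
      have "\<psi> (j * j) = \<psi> (of_real (-1))" unfolding real \<psi> j by simp
      then have "j * j = of_real (- 1)" using inj by (metis injD)
      then show "j = 0 \<or> j * j = -1" by simp
      fix c
      have "\<psi> c = \<psi> (of_real (Re (\<psi> c)) + of_real (Im (\<psi> c)) * j)"
        unfolding real \<psi> j by (simp add: complex_eq_iff)
      then show "\<exists>a b. c = of_real a + of_real b * j" using inj by (metis injD)
    qed
  qed
qed

lemma countable_dense_scalars:
  obtains Q :: "'k::real_or_complex set"
  where "countable Q" "\<And>c e. 0 < e \<Longrightarrow> \<exists>q\<in>Q. norm (c - q) < e"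
proof -
  obtain j :: 'k where coord: "\<And>c::'k. \<exists>a b. c = of_real a + of_real b * j"
    by (rule real_or_complex_coordinates) blast
  let ?Q = "(\<lambda>(a, b). of_real a + of_real b * j) ` (\<rat> \<times> \<rat>)"
  show ?thesis
  proof (rule that[of ?Q])
    show "countable ?Q" by (intro countable_image countable_SIGMA countable_rat)
    fix c :: 'k and e :: real assume e: "0 < e"
    obtain a b where c: "c = of_real a + of_real b * j" using coord by blast
    have d: "0 < e / (1 + norm j)" using e by (intro divide_pos_pos add_pos_nonneg) auto
    have approx: "\<exists>q\<in>\<rat>. \<bar>x - q\<bar> < e / (1 + norm j)" for x
    proof -
      obtain q where "q \<in> \<rat>" "x - e / (1 + norm j) < q" "q < x"
        using Rats_dense_in_real[of "x - e / (1 + norm j)" x] d by auto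
      then show ?thesis by (intro bexI[of _ q]) auto
    qed
    obtain a' b' where a': "a' \<in> \<rat>" "\<bar>a - a'\<bar> < e / (1 + norm j)"
      and b': "b' \<in> \<rat>" "\<bar>b - b'\<bar> < e / (1 + norm j)" using approx by blast
    let ?q = "of_real a' + of_real b' * j"
    have "c - ?q = of_real (a - a') + of_real (b - b') * j" by (simp add: c algebra_simps)
    then have "norm (c - ?q) \<le> \<bar>a - a'\<bar> + \<bar>b - b'\<bar> * norm j"
      by (metis norm_triangle_ineq norm_mult norm_of_real)
    also have "\<dots> < e / (1 + norm j) + e / (1 + norm j) * norm j"
      using a' b' by (intro add_less_le_mono mult_right_mono) auto
    also have "\<dots> = e / (1 + norm j) * (1 + norm j)" by (simp only: distrib_left mult_1_right)
    also have "\<dots> = e" using norm_ge_zero[of j] by (simp add: add_nonneg_eq_0_iff)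
    finally show "\<exists>q\<in>?Q. norm (c - q) < e" using a' b' by (intro bexI[of _ ?q]) auto
  qed
qed

lemma dual_space_iff:
  fixes scaleF :: "'k::real_or_complex \<Rightarrow> 'a::banach \<Rightarrow> 'a"
  assumes "banach_space_over scaleF"
  shows "f \<in> dual_space scaleF \<longleftrightarrow> (\<forall>x y. f (x + y) = f x + f y) \<and> (\<forall>c x. f (scaleF c x) = c * f x)
     \<and> (\<exists>K. \<forall>x. norm (f x) \<le> K * norm x)"
proof -
  have "vector_space scaleF" using assms by (simp add: banach_space_over_def)
  moreover have "vector_space ((*) :: 'k \<Rightarrow> 'k \<Rightarrow> 'k)"
    by unfold_locales (auto simp: algebra_simps)
  ultimately show ?thesis by (simp add: dual_space_def Vector_Spaces.linear_iff)
qed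

lemma dual_space_zero: "banach_space_over scaleF \<Longrightarrow> (\<lambda>x. 0) \<in> dual_space scaleF"
  by (auto simp: dual_space_iff intro: exI[of _ 0])

lemma dual_space_add:
  assumes "banach_space_over scaleF" "f \<in> dual_space scaleF" "g \<in> dual_space scaleF"
  shows "(\<lambda>x. f x + g x) \<in> dual_space scaleF"
proof -
  obtain K L where K: "\<And>x. norm (f x) \<le> K * norm x" "\<And>x. norm (g x) \<le> L * norm x"
    using assms by (auto simp: dual_space_iff)
  have "norm (f x + g x) \<le> (K + L) * norm x" for x
    using norm_triangle_ineq[of "f x" "g x"] K[of x] by (simp add: distrib_right)
  then have "\<exists>K. \<forall>x. norm (f x + g x) \<le> K * norm x" by blast
  then show ?thesis using assms by (simp add: dual_space_iff algebra_simps)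
qed

lemma dual_space_scale:
  assumes "banach_space_over scaleF" "f \<in> dual_space scaleF"
  shows "(\<lambda>x. c * f x) \<in> dual_space scaleF"
proof -
  obtain K where K: "\<And>x. norm (f x) \<le> K * norm x"
    using assms by (auto simp: dual_space_iff)
  have "norm (c * f x) \<le> (norm c * K) * norm x" for x
    using K[of x] mult_left_mono[OF K[of x], of "norm c"] by (simp add: norm_mult mult.assoc)
  then have "\<exists>K. \<forall>x. norm (c * f x) \<le> K * norm x" by blast
  then show ?thesis using assms by (simp add: dual_space_iff algebra_simps)
qed

text \<open>
The functional is \<open>u x - j u (j x)\<close>: this is \<open>u\<close> itself in the real case, and the usual
complex functional with real part \<open>u\<close> in the complex case.\<close>

lemma functional_with_smaller_kernel:
  fixes scaleF :: "'k::real_or_complex \<Rightarrow> 'a::banach \<Rightarrow> 'a"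
    and u :: "'a \<Rightarrow> real"
  assumes X: "banach_space_over scaleF" and u: "linear u" "\<And>x. \<bar>u x\<bar> \<le> norm x"
  obtains f where "f \<in> dual_space scaleF" "\<And>x. f x = 0 \<Longrightarrow> u x = 0"
proof -
  interpret banach_space_over scaleF by fact
  obtain j :: 'k where j: "j = 0 \<or> j * j = -1"
    and coord: "\<And>c::'k. \<exists>a b. c = of_real a + of_real b * j"
    by (rule real_or_complex_coordinates) blast
  define f where "f x = of_real (u x) - j * of_real (u (scaleF j x))" for x
  have f_add: "f (x + y) = f x + f y" for x y
    by (simp add: f_def scale_right_distrib linear_add[OF u(1)] algebra_simps)
  have f_real: "f (scaleF (of_real r) x) = of_real r * f x" for r x
  proof -
    have "scaleF j (r *\<^sub>R x) = r *\<^sub>R scaleF j x"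
      by (metis scaleF_of_real scale_left_commute)
    then show ?thesis by (simp add: f_def scaleF_of_real linear_scale[OF u(1)] algebra_simps)
  qed
  have f_j: "f (scaleF j x) = j * f x" for x
    using j
  proof
    assume "j = 0" then show ?thesis using linear_0[OF u(1)] by (simp add: f_def)
  next
    assume jj: "j * j = -1"
    have "scaleF j (scaleF j x) = - x" by (simp add: jj)
    then have "f (scaleF j x) = of_real (u (scaleF j x)) + j * of_real (u x)"
      using linear_neg[OF u(1), of x] by (simp add: f_def)
    also have "\<dots> = j * of_real (u x) - (j * j) * of_real (u (scaleF j x))" by (simp add: jj)
    also have "\<dots> = j * f x" by (simp only: f_def right_diff_distrib mult.assoc)
    finally show ?thesis .
  qed
  have f_scale: "f (scaleF c x) = c * f x" for c x
  proof -
    obtain a b where c: "c = of_real a + of_real b * j" using coord by blast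
    have "scaleF c x = scaleF (of_real a) x + scaleF (of_real b) (scaleF j x)"
      by (simp add: c scale_left_distrib)
    then have "f (scaleF c x) = of_real a * f x + of_real b * (j * f x)"
      by (simp only: f_add f_real f_j)
    then show ?thesis by (simp add: c distrib_right mult.assoc)
  qed
  have "norm (f x) \<le> (1 + norm j * norm j) * norm x" for x
  proof -
    have "norm (f x) \<le> norm (of_real (u x) :: 'k) + norm (j * of_real (u (scaleF j x)))"
      unfolding f_def by (rule norm_triangle_ineq4)
    also have "\<dots> = \<bar>u x\<bar> + norm j * \<bar>u (scaleF j x)\<bar>"
      by (simp add: norm_mult)
    also have "\<dots> \<le> norm x + norm j * (norm j * norm x)"
      using u(2)[of x] u(2)[of "scaleF j x"]
        by (intro add_mono mult_left_mono) (auto simp: norm_scaleF)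
    finally show ?thesis by (simp add: algebra_simps)
  qed
  then have "f \<in> dual_space scaleF"
    unfolding dual_space_iff[OF X] using f_add f_scale by blast
  moreover have "u x = 0" if "f x = 0" for x
    using j
  proof
    assume "j = 0" then show ?thesis using that by (simp add: f_def)
  next
    assume jj: "j * j = -1"
    define a b where "a = u x" and "b = u (scaleF j x)"
    have "of_real a = j * (of_real b :: 'k)" using that by (simp add: f_def a_def b_def)
    then have "of_real a * of_real a = (j * j) * (of_real b * (of_real b :: 'k))"
      by (simp only: mult_ac)
    then have "of_real (a * a + b * b) = (0 :: 'k)" by (simp add: jj)
    then have "a * a + b * b = 0" by (simp only: of_real_eq_0_iff)
    then show ?thesis by (simp add: a_def sum_squares_eq_zero_iff)
  qed
  ultimately show ?thesis using that by blast
qed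

section \<open>Common zeros and weak-star density\<close>

definition combination :: "('k \<times> ('a \<Rightarrow> 'k)) list \<Rightarrow> 'a \<Rightarrow> 'k::comm_ring_1" where
  "combination l x = (\<Sum>(c, f)\<leftarrow>l. c * f x)"

lemma combination_Nil [simp]: "combination [] x = 0"
  and combination_Cons [simp]: "combination ((c, f) # l) x = c * f x + combination l x"
  and combination_append: "combination (l @ l') x = combination l x + combination l' x"
  by (simp_all add: combination_def)

lemma combination_scale: "combination (map (\<lambda>(c, f). (a * c, f)) l) x = a * combination l x"
  by (induction l) (auto simp: algebra_simps)

lemma combination_in_dual:
  assumes "banach_space_over scaleF" "snd ` set l \<subseteq> dual_space scaleF"
  shows "combination l \<in> dual_space scaleF"
  using assms(2)
proof (induction l)
  case Nil
  then show ?case using dual_space_zero[OF assms(1)] by (simp add: combination_def[abs_def])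
next
  case (Cons p l)
  obtain c f where p: "p = (c, f)" by force
  have "(\<lambda>x. c * f x + combination l x) \<in> dual_space scaleF"
    using Cons p by (intro dual_space_add dual_space_scale assms(1)) auto
  then show ?case by (simp add: p combination_def[abs_def])
qed

text \<open>
Two inductions over the finite set \<open>A\<close>, with \<open>E\<close> the span of \<open>F\<close>. The first one,
\<open>determined\<close>, shows that if all elements of \<open>E\<close> that vanish on \<open>A\<close> vanish at \<open>x\<close>, then all
functionals that vanish on \<open>A\<close> do; in other words, \<open>x\<close> is in the span of \<open>A\<close>. Thus in the
second one either the interpolant can be corrected at the new point without changing it on
the other ones, or it has the right value already.\<close>

lemma separating_interpolation:
  fixes scaleF :: "'k::real_or_complex \<Rightarrow> 'a::banach \<Rightarrow> 'a"
  assumes X: "banach_space_over scaleF" and F: "F \<subseteq> dual_space scaleF"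
    and sep: "\<And>x. (\<And>f. f \<in> F \<Longrightarrow> f x = 0) \<Longrightarrow> x = 0"
    and A: "finite A" and g: "g \<in> dual_space scaleF"
  shows "\<exists>l. set l \<subseteq> UNIV \<times> F \<and> (\<forall>a\<in>A. combination l a = g a)"
proof -
  interpret banach_space_over scaleF by fact
  define E where "E = combination ` {l. set l \<subseteq> UNIV \<times> F}"
  have E_add: "(\<lambda>x. e x + e' x) \<in> E" if e: "e \<in> E" "e' \<in> E" for e e'
  proof -
    obtain l l' where l: "set l \<subseteq> UNIV \<times> F" "set l' \<subseteq> UNIV \<times> F" "e = combination l" "e' = combination l'"
      using e by (auto simp: E_def)
    then have "(\<lambda>x. e x + e' x) = combination (l @ l')"
      by (simp add: combination_append fun_eq_iff)
    then show ?thesis using l by (auto simp: E_def)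
  qed
  have E_scale: "(\<lambda>x. c * e x) \<in> E" if e: "e \<in> E" for c e
  proof -
    obtain l where l: "set l \<subseteq> UNIV \<times> F" "e = combination l"
      using e by (auto simp: E_def)
    then have "(\<lambda>x. c * e x) = combination (map (\<lambda>(a, f). (c * a, f)) l)"
      by (simp add: combination_scale fun_eq_iff)
    then show ?thesis unfolding E_def
      by (rule image_eqI) (use l in auto)
  qed
  have E_dual: "e \<in> dual_space scaleF" if "e \<in> E" for e
    using that F unfolding E_def by (force intro!: combination_in_dual[OF X])
  have E_zero: "(\<lambda>x. 0) \<in> E"
    unfolding E_def by (rule image_eqI[of _ _ "[]"]) (auto simp: fun_eq_iff)
  have E_sep: "x = 0" if "\<And>e. e \<in> E \<Longrightarrow> e x = 0" for x
  proof (rule sep)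
    fix f assume "f \<in> F"
    then have "combination [(1, f)] \<in> E" by (auto simp: E_def)
    then show "f x = 0" using that by force
  qed
  have add: "h (x + y) = h x + h y" and scale: "h (scaleF c x) = c * h x"
    if "h \<in> dual_space scaleF" for h x y c
    using that by (simp_all add: dual_space_iff[OF X])
  have diff: "h (x - scaleF c y) = h x - c * h y" if "h \<in> dual_space scaleF" for h x y c
    using add[OF that, of "x - scaleF c y" "scaleF c y"] scale[OF that] by simp
  have determined: "h x = 0"
    if "finite A" "h \<in> dual_space scaleF" "\<And>a. a \<in> A \<Longrightarrow> h a = 0"
      "\<And>e. e \<in> E \<Longrightarrow> (\<And>a. a \<in> A \<Longrightarrow> e a = 0) \<Longrightarrow> e x = 0" for A h x
    using that
  proof (induction A arbitrary: x rule: finite_induct)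
    case empty
    have "x = 0" by (rule E_sep, rule empty.prems(3)) auto
    then show ?case using scale[OF empty.prems(1), of 0 0] by simp
  next
    case (insert a A)
    show ?case
    proof (cases "\<forall>e\<in>E. (\<forall>b\<in>A. e b = 0) \<longrightarrow> e a = 0")
      case True
      show ?thesis
      proof (rule insert.IH[OF insert.prems(1)])
        show "h b = 0" if "b \<in> A" for b using insert.prems(2) that by blast
        show "e x = 0" if "e \<in> E" "\<And>b. b \<in> A \<Longrightarrow> e b = 0" for e
        proof (rule insert.prems(3)[OF that(1)])
          show "e b = 0" if "b \<in> insert a A" for b
            using that True \<open>e \<in> E\<close> \<open>\<And>b. b \<in> A \<Longrightarrow> e b = 0\<close> by blast
        qed
      qed
    next
      case False
      then obtain e1 where e1: "e1 \<in> E" "\<forall>b\<in>A. e1 b = 0" "e1 a \<noteq> 0" by blast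
      define e0 where "e0 = (\<lambda>x. inverse (e1 a) * e1 x)"
      have e0: "e0 \<in> E" "\<And>b. b \<in> A \<Longrightarrow> e0 b = 0" "e0 a = 1"
        using e1 E_scale[OF e1(1), of "inverse (e1 a)"] by (auto simp: e0_def)
      have "h (x - scaleF (e0 x) a) = 0"
      proof (rule insert.IH)
        show "h \<in> dual_space scaleF" "\<And>b. b \<in> A \<Longrightarrow> h b = 0"
          using insert.prems by auto
        fix e assume e: "e \<in> E" "\<And>b. b \<in> A \<Longrightarrow> e b = 0"
        have "(\<lambda>x. e x + (- e a) * e0 x) x = 0"
        proof (rule insert.prems(3)[of "\<lambda>x. e x + (- e a) * e0 x"])
          show "(\<lambda>x. e x + (- e a) * e0 x) \<in> E" using e e0 by (intro E_add E_scale)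
        qed (use e e0 in auto)
        then show "e (x - scaleF (e0 x) a) = 0"
          using diff[OF E_dual[OF e(1)]] by (simp add: mult.commute)
      qed
      then show ?thesis using diff[OF insert.prems(1)] insert.prems(2)[of a] by simp
    qed
  qed
  have "\<exists>e\<in>E. \<forall>a\<in>A. e a = g a"
    using A
  proof (induction A rule: finite_induct)
    case empty then show ?case using E_zero by blast
  next
    case (insert x A)
    then obtain e where e: "e \<in> E" "\<forall>a\<in>A. e a = g a" by blast
    show ?case
    proof (cases "\<exists>e1\<in>E. (\<forall>a\<in>A. e1 a = 0) \<and> e1 x \<noteq> 0")
      case True
      then obtain e1 where e1: "e1 \<in> E" "\<forall>a\<in>A. e1 a = 0" "e1 x \<noteq> 0" by blast
      show ?thesis
      proof (rule bexI)
        show "(\<lambda>y. e y + ((g x - e x) / e1 x) * e1 y) \<in> E"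
          using e e1 by (intro E_add E_scale) auto
      qed (use e e1 in auto)
    next
      case False
      define h where "h = (\<lambda>y. g y + (- 1) * e y)"
      have h: "h \<in> dual_space scaleF"
        unfolding h_def by (rule dual_space_add[OF X g dual_space_scale[OF X E_dual[OF e(1)]]])
      have "h a = 0" if "a \<in> A" for a using e that by (simp add: h_def)
      moreover have "e1 x = 0" if "e1 \<in> E" "\<And>a. a \<in> A \<Longrightarrow> e1 a = 0"
        for e1 using False that by blast
      ultimately have "h x = 0" by (rule determined[OF insert.hyps(1) h])
      then have "e x = g x" by (simp add: h_def)
      then show ?thesis using e by (intro bexI[of _ e]) auto
    qed
  qed
  then show ?thesis by (auto simp: E_def)
qed

lemma combination_approx:
  fixes F :: "('a \<Rightarrow> 'k::real_normed_field) set"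
  assumes Q: "\<And>c e. 0 < e \<Longrightarrow> \<exists>q\<in>Q. norm (c - q) < e"
    and A: "finite A"
    and "set l \<subseteq> UNIV \<times> F" "0 < e"
  shows "\<exists>l'. set l' \<subseteq> Q \<times> F \<and> (\<forall>a\<in>A. norm (combination l a - combination l' a) < e)"
  using assms(3,4)
proof (induction l arbitrary: e)
  case Nil
  then show ?case by (intro exI[of _ "[]"]) auto
next
  case (Cons p l)
  obtain c f where p: "p = (c, f)" "f \<in> F" using Cons.prems by auto
  obtain l' where l': "set l' \<subseteq> Q \<times> F" "\<forall>a\<in>A. norm (combination l a - combination l' a) < e / 2"
    using Cons.IH[of "e/2"] Cons.prems by auto
  define m where "m = 1 + (\<Sum>a\<in>A. norm (f a))"
  have m: "0 < m" unfolding m_def by (intro add_pos_nonneg sum_nonneg) auto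
  have fm: "norm (f a) \<le> m" if "a \<in> A" for a
    using member_le_sum[OF that, of "\<lambda>a. norm (f a)"] A by (simp add: m_def)
  obtain q where q: "q \<in> Q" "norm (c - q) < e / (2 * m)"
    using Q[of "e / (2 * m)" c] m Cons.prems by auto
  have "norm (combination (p # l) a - combination ((q, f) # l') a) < e" if a: "a \<in> A" for a
  proof -
    have "combination (p # l) a - combination ((q, f) # l') a = (c - q) * f a + (combination l a - combination l' a)"
      by (simp add: p algebra_simps)
    then have "norm (combination (p # l) a - combination ((q, f) # l') a)
        \<le> norm (c - q) * norm (f a) + norm (combination l a - combination l' a)"
      by (metis norm_triangle_ineq norm_mult)
    also have "norm (c - q) * norm (f a) \<le> e / (2 * m) * m"
      using q(2) fm[OF a] m Cons.prems by (intro mult_mono) auto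
    also have "e / (2 * m) * m = e / 2" using m by simp
    finally show ?thesis using l'(2) a by fastforce
  qed
  then show ?case using l'(1) q(1) p(2) by (intro exI[of _ "(q, f) # l'"]) auto
qed

text \<open>
A basic weak-star neighbourhood restricts the values at finitely many points only.
Interpolate there by a combination with arbitrary coefficients, and then approximate these
by elements of \<open>Q\<close>.\<close>

lemma separating_imp_combinations_dense:
  fixes scaleF :: "'k::real_or_complex \<Rightarrow> 'a::banach \<Rightarrow> 'a"
  assumes X: "banach_space_over scaleF" and F: "F \<subseteq> dual_space scaleF"
    and sep: "\<And>x. (\<And>f. f \<in> F \<Longrightarrow> f x = 0) \<Longrightarrow> x = 0"
    and Q: "\<And>c e. 0 < e \<Longrightarrow> \<exists>q\<in>Q. norm (c - q) < e"
  shows "dense_in (weak_star_topology scaleF) (combination ` lists (Q \<times> F))"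
proof -
  let ?D = "combination ` lists (Q \<times> F)" and ?T = "weak_star_topology scaleF"
  have top: "topspace ?T = dual_space scaleF"
    by (simp add: weak_star_topology_def)
  have D: "?D \<subseteq> dual_space scaleF"
    using F by (force intro!: combination_in_dual[OF X] simp: lists_eq_set)
  have "g \<in> ?T closure_of ?D" if g: "g \<in> dual_space scaleF" for g
    unfolding in_closure_of
  proof (intro conjI allI impI)
    show "g \<in> topspace ?T" using g top by simp
    fix U assume "g \<in> U \<and> openin ?T U"
    then obtain W where W: "openin (product_topology (\<lambda>_::'a. euclidean) UNIV) W" "U = W \<inter> dual_space scaleF" "g \<in> W"
      by (auto simp: weak_star_topology_def openin_subtopology)
    then obtain V where V: "finite {i \<in> UNIV. V i \<noteq> topspace (euclidean :: 'k topology)}" "\<And>i. openin euclidean (V i)"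
      "g \<in> Pi\<^sub>E UNIV V" "Pi\<^sub>E UNIV V \<subseteq> W"
      using bspec[OF iffD1[OF openin_product_topology_alt W(1)] W(3)] by auto
    define A where "A = {i. V i \<noteq> UNIV}"
    have A: "finite A" using V(1) by (simp add: A_def)
    have "\<exists>e>0. \<forall>a\<in>A. ball (g a) e \<subseteq> V a"
      using A
    proof (induction A rule: finite_induct)
      case empty then show ?case by (auto intro: exI[of _ 1])
    next
      case (insert x A)
      then obtain e where e: "0 < e" "\<forall>a\<in>A. ball (g a) e \<subseteq> V a" by blast
      have "open (V x)" "g x \<in> V x" using V by auto
      then obtain d where d: "0 < d" "ball (g x) d \<subseteq> V x"
        using open_contains_ball by blast
      have "ball (g a) (min d e) \<subseteq> V a" if "a \<in> insert x A" for a
        using that d e subset_ball[of "min d e" d "g x"] subset_ball[of "min d e" e "g a"] by force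
      then show ?case using d e by (intro exI[of _ "min d e"]) auto
    qed
    then obtain e where e: "0 < e" "\<forall>a\<in>A. ball (g a) e \<subseteq> V a" by blast
    obtain l where l: "set l \<subseteq> UNIV \<times> F" "\<forall>a\<in>A. combination l a = g a"
      using separating_interpolation[OF X F sep A g] by blast
    obtain l' where l': "set l' \<subseteq> Q \<times> F" "\<forall>a\<in>A. norm (combination l a - combination l' a) < e"
      using combination_approx[OF Q A l(1) e(1)] by blast
    have "combination l' a \<in> V a" for a
    proof (cases "a \<in> A")
      case True
      then have "combination l' a \<in> ball (g a) e" using l(2) l'(2) by (simp add: dist_norm)
      then show ?thesis using e(2) True by blast
    qed (simp add: A_def)
    then have "combination l' \<in> W" using V(4) by auto
    moreover have "combination l' \<in> ?D" using l'(1) by (intro imageI) (auto simp: lists_eq_set)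
    ultimately show "\<exists>y. y \<in> ?D \<and> y \<in> U" using D W(2) by blast
  qed
  then have "?T closure_of ?D = topspace ?T"
    using top closure_of_subset_topspace[of ?T ?D] by blast
  then show ?thesis using D top by (simp add: dense_in_def)
qed

lemma card_lists_ordLeq_infinite:
  assumes B: "infinite B" and A: "|A| \<le>o |B|"
  shows "|lists A| \<le>o |B|"
proof -
  have "|{l. length l = n \<and> set l \<subseteq> A}| \<le>o |B|" for n
  proof (induction n)
    case 0
    have "{l. length l = 0 \<and> set l \<subseteq> A} = {[]}" by auto
    then show ?case
      using B by (simp add: card_of_singl_ordLeq) (metis card_of_singl_ordLeq finite.emptyI)
  next
    case (Suc n)
    have "{l. length l = Suc n \<and> set l \<subseteq> A} = (\<lambda>(a, l). a # l) ` (A \<times> {l. length l = n \<and> set l \<subseteq> A})"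
      by (auto simp: length_Suc_conv image_iff)
    moreover have "|A \<times> {l. length l = n \<and> set l \<subseteq> A}| \<le>o |B|"
      using B A Suc by (intro card_of_Sigma_ordLeq_infinite) auto
    ultimately show ?case by (simp only:) (rule ordLeq_transitive[OF card_of_image])
  qed
  then have "|\<Union>n. {l. length l = n \<and> set l \<subseteq> A}| \<le>o |B|"
    using B infinite_iff_card_of_nat by (intro card_of_UNION_ordLeq_infinite) auto
  moreover have "(\<Union>n. {l. length l = n \<and> set l \<subseteq> A}) = lists A"
    by (auto simp: lists_eq_set)
  ultimately show ?thesis by simp
qed

lemma separating_imp_density_character_le:
  fixes scaleF :: "'k::real_or_complex \<Rightarrow> 'a::banach \<Rightarrow> 'a"
  assumes X: "banach_space_over scaleF" and F: "F \<subseteq> dual_space scaleF"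
    and sep: "\<And>x. (\<And>f. f \<in> F \<Longrightarrow> f x = 0) \<Longrightarrow> x = 0"
    and B: "infinite B" "|F| \<le>o |B|"
  shows "density_character (weak_star_topology scaleF) \<le>o |B|"
proof -
  obtain Q :: "'k set" where Q: "countable Q" "\<And>c e. 0 < e \<Longrightarrow> \<exists>q\<in>Q. norm (c - q) < e"
    by (rule countable_dense_scalars) blast
  have "|Q| \<le>o |UNIV :: nat set|" using Q(1) by (simp add: countable_card_of_nat)
  moreover have "|UNIV :: nat set| \<le>o |B|" using B(1) infinite_iff_card_of_nat by blast
  ultimately have "|Q| \<le>o |B|" by (rule ordLeq_transitive)
  then have "|Q \<times> F| \<le>o |B|" using B by (intro card_of_Sigma_ordLeq_infinite) auto
  then have "|lists (Q \<times> F)| \<le>o |B|" by (rule card_lists_ordLeq_infinite[OF B(1)])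
  then have "|combination ` lists (Q \<times> F)| \<le>o |B|"
    by (rule ordLeq_transitive[OF card_of_image])
  with density_character_least[OF separating_imp_combinations_dense[OF X F sep Q(2)]]
  show ?thesis by (rule ordLeq_transitive)
qed

text \<open>
Otherwise \<open>F\<close> separates points, and its combinations with coefficients in a countable dense
set of scalars form a weak-star dense set of cardinality at most \<open>|F|\<close> or \<open>\<aleph>\<^sub>0\<close>.\<close>

lemma few_functionals_common_zero:
  fixes scaleF :: "'k::real_or_complex \<Rightarrow> 'a::banach \<Rightarrow> 'a"
  assumes X: "banach_space_over scaleF" and F: "F \<subseteq> dual_space scaleF"
    and card: "|F| <o density_character (weak_star_topology scaleF)"
    and uncountable: "|UNIV :: nat set| <o density_character (weak_star_topology scaleF)"
  shows "\<exists>x. x \<noteq> 0 \<and> (\<forall>f\<in>F. f x = 0)"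
proof (rule ccontr)
  assume "\<not> ?thesis"
  then have sep: "\<And>x. (\<And>f. f \<in> F \<Longrightarrow> f x = 0) \<Longrightarrow> x = 0"
    by blast
  show False
  proof (cases "finite F")
    case True
    then have "countable F" by (rule countable_finite)
    then have "|F| \<le>o |UNIV :: nat set|" by (simp only: countable_card_of_nat)
    then have "density_character (weak_star_topology scaleF) \<le>o |UNIV :: nat set|"
      by (intro separating_imp_density_character_le[OF X F] sep infinite_UNIV_nat)
    then show False using uncountable not_ordLess_ordLeq by blast
  next
    case False
    have "|F| \<le>o |F|" by (rule ordIso_imp_ordLeq[OF card_of_refl])
    then have "density_character (weak_star_topology scaleF) \<le>o |F|"
      by (intro separating_imp_density_character_le[OF X F] sep False)
    then show False using card not_ordLess_ordLeq by blast
  qed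
qed

section \<open>One step of the recursion\<close>

text \<open>
Let \<open>Y\<close> be the common kernel of \<open>F\<close>. The Radon-Nikodym property yields \<open>x\<close> and \<open>\<eta>\<close> such that
the closed convex hull of the bad vectors \<open>y \<in> Y\<close>, those with \<open>norm y \<ge> 1\<close> and
\<open>norm (x + y) < 1 + \<eta>\<close>, does not contain \<open>0\<close>. Hence some functional \<open>f\<close> has no bad vector in
its kernel.\<close>

lemma ex_next_vector:
  fixes scaleF :: "'k::real_or_complex \<Rightarrow> 'a::banach \<Rightarrow> 'a"
  assumes X: "banach_space_over scaleF" and rnp: "radon_nikodym_property TYPE('a)"
    and F: "F \<subseteq> dual_space scaleF"
    and card: "|F| <o density_character (weak_star_topology scaleF)"
    and uncountable: "|UNIV :: nat set| <o density_character (weak_star_topology scaleF)"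
  shows "\<exists>x f \<eta>. norm x = 1 \<and> (\<forall>h\<in>F. h x = 0) \<and> f \<in> dual_space scaleF \<and> 0 < \<eta> \<and>
    (\<forall>y. norm y = 1 \<longrightarrow> (\<forall>h\<in>F. h y = 0) \<longrightarrow> f y = 0 \<longrightarrow> 1 + \<eta> \<le> norm (x + y))"
proof -
  define Y where "Y = {y. \<forall>h\<in>F. h y = 0}"
  have lin: "h (x + y) = h x + h y" "h (r *\<^sub>R x) = of_real r * h x" if "h \<in> F" for h x y r
  proof -
    have h: "h \<in> dual_space scaleF" using that F by blast
    show "h (x + y) = h x + h y" using h by (simp add: dual_space_iff[OF X])
    have "h (scaleF (of_real r) x) = of_real r * h x" using h by (simp add: dual_space_iff[OF X])
    then show "h (r *\<^sub>R x) = of_real r * h x"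
      by (simp add: banach_space_over.scaleF_of_real[OF X])
  qed
  have Y: "subspace Y"
  proof (rule subspaceI)
    show "0 \<in> Y" using lin(2)[of _ 0 0] by (simp add: Y_def)
  qed (auto simp: Y_def lin)
  obtain w where w: "w \<in> Y" "w \<noteq> 0"
    using few_functionals_common_zero[OF X F card uncountable] by (auto simp: Y_def)
  obtain x \<eta> where x: "x \<in> Y" "norm x = 1" "0 < \<eta>"
    and avoid: "0 \<notin> closure (convex hull {y \<in> Y. 1 \<le> norm y \<and> norm (x + y) < 1 + \<eta>})"
    by (rule rnp_convex_hull_avoids_zero[OF rnp Y w])
  let ?K = "convex hull {y \<in> Y. 1 \<le> norm y \<and> norm (x + y) < 1 + \<eta>}"
  obtain r where r: "0 < r" "\<And>k. k \<in> ?K \<Longrightarrow> r \<le> norm k"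
    using avoid unfolding closure_approachable by (auto simp: not_less)
  obtain u :: "'a \<Rightarrow> real" where u: "linear u" "\<And>y. \<bar>u y\<bar> \<le> norm y" "\<And>k. k \<in> ?K \<Longrightarrow> r \<le> u k"
    by (rule separate_convex_from_ball[of ?K r, OF convex_convex_hull r]) (assumption, rule that)
  obtain f where f: "f \<in> dual_space scaleF" "\<And>y. f y = 0 \<Longrightarrow> u y = 0"
    by (rule functional_with_smaller_kernel[OF X u(1,2)]) blast
  have "1 + \<eta> \<le> norm (x + y)" if y: "norm y = 1" "\<forall>h\<in>F. h y = 0" "f y = 0"
    for y
  proof (rule ccontr)
    assume "\<not> 1 + \<eta> \<le> norm (x + y)"
    then have "y \<in> ?K" using y by (intro hull_inc) (simp add: Y_def)
    then show False using u(3) f(2)[OF y(3)] r(1) by fastforce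
  qed
  then show ?thesis using x f(1) unfolding Y_def by blast
qed

section \<open>Uncountable cofinality\<close>

text \<open>
An infinite cardinal is a cofinal subset of itself, since it has no largest element; so \<open>\<kappa>\<close>
is not \<open>\<aleph>\<^sub>0\<close>.\<close>

lemma uncountable_cofinality_imp_uncountable:
  assumes \<kappa>: "Card_order \<kappa>" "uncountable_cofinality \<kappa>"
  shows "|UNIV :: nat set| <o \<kappa>"
proof (rule ccontr)
  have inf: "infinite (Field \<kappa>)"
    using \<kappa>(2) by (simp add: uncountable_cofinality_def cinfinite_def)
  have "cofinal (Field \<kappa>) \<kappa>"
    unfolding cofinal_def using infinite_Card_order_limit[OF \<kappa>(1) inf] by blast
  then have "\<not> countable (Field \<kappa>)"
    using \<kappa>(2) by (auto simp: uncountable_cofinality_def)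
  moreover assume "\<not> ?thesis"
  then have "\<kappa> \<le>o |UNIV :: nat set|"
    using \<kappa>(1)
      by (simp add: not_ordLess_iff_ordLeq card_of_Well_order card_order_on_well_order_on)
  then have "|Field \<kappa>| \<le>o |UNIV :: nat set|"
    using card_of_Field_ordIso[OF \<kappa>(1)] ordIso_ordLeq_trans by blast
  ultimately show False by (simp add: countable_card_of_nat)
qed

text \<open>
For a singular \<open>\<kappa>\<close> a cofinal member of the cover can still be small. Therefore one compares
cardinalities: if each \<open>S n\<close> were smaller than \<open>\<kappa>\<close>, it would be at most as large as the
initial segment below some \<open>a n\<close>. All \<open>a n\<close> lie below a common \<open>b\<close>, and the countable union
would be at most as large as the initial segment below \<open>b\<close>, or countable.\<close>

lemma uncountable_cofinality_countable_cover:
  fixes S :: "nat \<Rightarrow> 'c set" and \<kappa> :: "'c rel"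
  assumes \<kappa>: "Card_order \<kappa>" "uncountable_cofinality \<kappa>"
    and S: "(\<Union>n. S n) = Field \<kappa>"
  shows "\<exists>n. |S n| =o \<kappa>"
proof (rule ccontr)
  assume no: "\<not> ?thesis"
  have WO: "Well_order \<kappa>" using \<kappa>(1) card_order_on_well_order_on by blast
  then have W: "wo_rel \<kappa>" by (simp add: wo_rel_def)
  have "|S n| <o \<kappa>" for n
  proof -
    have "S n \<subseteq> Field \<kappa>" using S by blast
    then have "|S n| \<le>o |Field \<kappa>|" by (rule card_of_mono1)
    then have "|S n| \<le>o \<kappa>"
      using card_of_Field_ordIso[OF \<kappa>(1)] by (rule ordLeq_ordIso_trans)
    then show ?thesis using no ordLeq_iff_ordLess_or_ordIso by blast
  qed
  then have "\<exists>a\<in>Field \<kappa>. |S n| \<le>o |underS \<kappa> a|" for n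
  proof -
    obtain a where a: "a \<in> Field \<kappa>" "|S n| =o Restr \<kappa> (underS \<kappa> a)"
      using ordLess_iff_ordIso_Restr[OF WO card_of_Well_order[of "S n"]] \<open>|S n| <o \<kappa>\<close> by blast
    have "|Field |S n| | \<le>o |Field (Restr \<kappa> (underS \<kappa> a))|"
      using a(2) by (intro card_of_mono2 ordIso_imp_ordLeq)
    then have "|S n| \<le>o |Field (Restr \<kappa> (underS \<kappa> a))|"
      by (simp add: Field_card_of)
    moreover have "|Field (Restr \<kappa> (underS \<kappa> a))| \<le>o |underS \<kappa> a|"
      by (intro card_of_mono1) (auto simp: Field_def)
    ultimately show ?thesis using a(1) ordLeq_transitive by blast
  qed
  then obtain a where a: "\<And>n. a n \<in> Field \<kappa>" "\<And>n. |S n| \<le>o |underS \<kappa> (a n)|" by metis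
  have "\<not> cofinal (range a) \<kappa>"
    using \<kappa>(2) a(1)
      unfolding uncountable_cofinality_def by (metis countable_image countableI_type image_subsetI)
  then obtain b where b: "b \<in> Field \<kappa>" "\<And>n. b = a n \<or> (b, a n) \<notin> \<kappa>"
    unfolding cofinal_def by blast
  have "(a n, b) \<in> \<kappa>" for n
    using b(2)[of n] b(1) a(1)[of n] wo_rel.TOTALS[OF W] by (metis)
  then have incr: "underS \<kappa> (a n) \<subseteq> underS \<kappa> b" for n
    by (intro underS_incr wo_rel.TRANS[OF W] wo_rel.ANTISYM[OF W])
  have Sb: "|S n| \<le>o |underS \<kappa> b|" for n
    by (rule ordLeq_transitive[OF a(2) card_of_mono1[OF incr]])
  have less: "|underS \<kappa> b| <o \<kappa>" by (rule card_of_underS[OF \<kappa>(1) b(1)])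
  show False
  proof (cases "finite (underS \<kappa> b)")
    case True
    then have "countable (S n)" for n
      using card_of_ordLeq_finite[OF Sb] countable_finite by blast
    then have "countable (Field \<kappa>)" unfolding S[symmetric] by blast
    then have "|Field \<kappa>| \<le>o |UNIV :: nat set|" by (simp add: countable_card_of_nat)
    then have "\<kappa> \<le>o |UNIV :: nat set|"
      using card_of_Field_ordIso[OF \<kappa>(1)] ordIso_symmetric ordIso_ordLeq_trans by blast
    then show False
      using uncountable_cofinality_imp_uncountable[OF \<kappa>] not_ordLess_ordLeq by blast
  next
    case False
    then have "|\<Union>n. S n| \<le>o |underS \<kappa> b|"
      using Sb infinite_iff_card_of_nat by (intro card_of_UNION_ordLeq_infinite) auto
    then have "\<kappa> \<le>o |underS \<kappa> b|"
      unfolding S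
        using card_of_Field_ordIso[OF \<kappa>(1)] ordIso_symmetric ordIso_ordLeq_trans by blast
    then show False using less not_ordLess_ordLeq by blast
  qed
qed

section \<open>Symmetrically separated sets of unit vectors\<close>

theorem theorem4p11:
  fixes scaleF :: "'k::real_or_complex \<Rightarrow> 'a::banach \<Rightarrow> 'a"
    and \<kappa> :: "'c rel"
  assumes "banach_space_over scaleF"
    and "infinite_dimensional scaleF"
    and "radon_nikodym_property TYPE('a)"
    and "Card_order \<kappa>"
    and "\<kappa> \<le>o density_character (weak_star_topology scaleF)"
    and "uncountable_cofinality \<kappa>"
  shows "\<exists>\<epsilon>>0. \<exists>A \<subseteq> sphere (0::'a) 1. symmetrically_separated (1 + \<epsilon>) A \<and> |A| =o \<kappa>"
proof -
  note X = assms(1) and rnp = assms(3) and \<kappa> = assms(4,6) and dens = assms(5)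
  have WO: "Well_order \<kappa>" using \<kappa>(1) card_order_on_well_order_on by blast
  then have W: "wo_rel \<kappa>" by (simp add: wo_rel_def)
  have uncountable: "|UNIV :: nat set| <o density_character (weak_star_topology scaleF)"
    by (rule ordLess_ordLeq_trans[OF uncountable_cofinality_imp_uncountable[OF \<kappa>] dens])
  \<comment> \<open>The choice at \<open>a\<close> is a triple \<open>(x, f, \<eta>)\<close> that depends only on the functionals chosen before.\<close>
  define next_vector where "next_vector F r \<longleftrightarrow> (case r of (x, f, \<eta>) \<Rightarrow>
      norm x = 1 \<and> (\<forall>h\<in>F. h x = 0) \<and> f \<in> dual_space scaleF \<and> 0 < \<eta> \<and>
      (\<forall>y. norm y = 1 \<longrightarrow> (\<forall>h\<in>F. h y = 0) \<longrightarrow> f y = 0 \<longrightarrow> 1 + \<eta> \<le> norm (x + y)))"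
    for F :: "('a \<Rightarrow> 'k) set" and r :: "'a \<times> ('a \<Rightarrow> 'k) \<times> real"
  define prev where "prev s a = (fst \<circ> snd \<circ> s) ` underS \<kappa> a"
    for s :: "'c \<Rightarrow> 'a \<times> ('a \<Rightarrow> 'k) \<times> real" and a
  have "\<exists>s. \<forall>a. a \<in> Field \<kappa> \<longrightarrow> next_vector (prev s a) (s a)"
  proof (rule dependent_wf_choice[of "\<kappa> - Id"])
    show "wf (\<kappa> - Id)" by (rule wo_rel.WF[OF W])
    show "(a \<in> Field \<kappa> \<longrightarrow> next_vector (prev s a) r) = (a \<in> Field \<kappa> \<longrightarrow> next_vector (prev s' a) r)"
      if "\<And>z. (z, a) \<in> \<kappa> - Id \<Longrightarrow> s z = s' z" for s s' a r
    proof -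
      have "prev s a = prev s' a"
        unfolding prev_def using that by (intro image_cong refl) (auto simp: underS_def)
      then show ?thesis by simp
    qed
    show "\<exists>r. a \<in> Field \<kappa> \<longrightarrow> next_vector (prev s a) r"
      if IH: "\<And>b. (b, a) \<in> \<kappa> - Id \<Longrightarrow> b \<in> Field \<kappa> \<longrightarrow> next_vector (prev s b) (s b)" for a s
    proof (cases "a \<in> Field \<kappa>")
      case True
      have "prev s a \<subseteq> dual_space scaleF"
      proof
        fix f assume "f \<in> prev s a"
        then obtain b where b: "b \<noteq> a" "(b, a) \<in> \<kappa>" "f = fst (snd (s b))"
          by (auto simp: prev_def underS_def)
        then have "next_vector (prev s b) (s b)" using IH by (auto intro: FieldI1)
        then show "f \<in> dual_space scaleF" using b(3) by (auto simp: next_vector_def)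
      qed
      moreover have "|prev s a| <o density_character (weak_star_topology scaleF)"
        unfolding prev_def
        by (rule ordLeq_ordLess_trans[OF card_of_image ordLess_ordLeq_trans[OF card_of_underS[OF \<kappa>(1) True] dens]])
      ultimately have "\<exists>r. next_vector (prev s a) r"
        using ex_next_vector[OF X rnp _ _ uncountable, of "prev s a"]
        unfolding next_vector_def by auto
      then show ?thesis by blast
    qed blast
  qed
  then obtain s where s: "\<And>a. a \<in> Field \<kappa> \<Longrightarrow> next_vector (prev s a) (s a)" by blast
  define x where "x a = fst (s a)" for a
  define f where "f a = fst (snd (s a))" for a
  define \<eta> where "\<eta> a = snd (snd (s a))" for a
  have s': "norm (x a) = 1" "0 < \<eta> a" "\<And>b. b \<in> underS \<kappa> a \<Longrightarrow> f b (x a) = 0" "f a \<in> dual_space scaleF"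
    "\<And>y. norm y = 1 \<Longrightarrow> (\<And>b. b \<in> underS \<kappa> a \<Longrightarrow> f b y = 0) \<Longrightarrow> f a y = 0 \<Longrightarrow> 1 + \<eta> a \<le> norm (x a + y)"
    if "a \<in> Field \<kappa>" for a
    using s[OF that] by (auto simp: next_vector_def prev_def x_def f_def \<eta>_def split_beta)
  \<comment> \<open>All functionals chosen up to \<open>b\<close> vanish at the later \<open>x a\<close>, and so they do at \<open>- x a\<close>.\<close>
  have sep: "1 + \<eta> b \<le> norm (x b + x a) \<and> 1 + \<eta> b \<le> norm (x b - x a)"
    if b: "b \<in> underS \<kappa> a" for a b
  proof -
    have ab: "a \<in> Field \<kappa>" "b \<in> Field \<kappa>" "(b, a) \<in> \<kappa>"
      using b by (auto simp: underS_def Field_def)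
    have sub: "underS \<kappa> b \<subseteq> underS \<kappa> a"
      by (rule underS_incr[OF wo_rel.TRANS[OF W] wo_rel.ANTISYM[OF W] ab(3)])
    have zero: "f c (- x a) = 0 \<and> f c (x a) = 0" if "c \<in> underS \<kappa> a" for c
    proof -
      have c: "c \<in> Field \<kappa>" using that by (auto simp: underS_def Field_def)
      have "f c (scaleF (-1) (x a)) = -1 * f c (x a)"
        using s'(4)[OF c] by (simp add: dual_space_iff[OF X])
      moreover have "scaleF (-1) (x a) = - x a"
        using banach_space_over.scaleF_of_real[OF X, of "-1" "x a"] by simp
      ultimately show ?thesis using s'(3)[OF ab(1) that] by simp
    qed
    have "1 + \<eta> b \<le> norm (x b + x a)" "1 + \<eta> b \<le> norm (x b + - x a)"
      using zero b sub s'(1)[OF ab(1)] by (intro s'(5)[OF ab(2)]; auto)+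
    then show ?thesis by simp
  qed
  have sep2: "1 + min (\<eta> a) (\<eta> b) \<le> norm (x a + x b) \<and> 1 + min (\<eta> a) (\<eta> b) \<le> norm (x a - x b)"
    if ab: "a \<in> Field \<kappa>" "b \<in> Field \<kappa>" "a \<noteq> b" for a b
  proof -
    have "a \<in> underS \<kappa> b \<or> b \<in> underS \<kappa> a"
      using wo_rel.TOTALS[OF W] ab by (auto simp: underS_def)
    then show ?thesis
      using sep[of a b] sep[of b a] by (auto simp: add.commute norm_minus_commute)
  qed
  have inj: "inj_on x (Field \<kappa>)"
  proof (rule inj_onI, rule ccontr)
    fix a b assume ab: "a \<in> Field \<kappa>" "b \<in> Field \<kappa>" "x a = x b" "a \<noteq> b"
    then have "1 + min (\<eta> a) (\<eta> b) \<le> 0" using sep2[of a b] by simp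
    moreover have "0 < min (\<eta> a) (\<eta> b)" using s'(2) ab by simp
    ultimately show False by linarith
  qed
  define S where "S n = {a \<in> Field \<kappa>. 1 / real (Suc n) \<le> \<eta> a}" for n
  have "(\<Union>n. S n) = Field \<kappa>"
  proof
    show "Field \<kappa> \<subseteq> (\<Union>n. S n)"
    proof
      fix a assume a: "a \<in> Field \<kappa>"
      obtain n where "1 / real (Suc n) < \<eta> a" using nat_approx_posE[OF s'(2)[OF a]] by blast
      then show "a \<in> (\<Union>n. S n)" using a by (auto simp: S_def intro!: exI[of _ n])
    qed
  qed (auto simp: S_def)
  then obtain n where n: "|S n| =o \<kappa>"
    using uncountable_cofinality_countable_cover[OF \<kappa>] by blast
  have SF: "S n \<subseteq> Field \<kappa>" by (auto simp: S_def)
  have "|S n| =o |x ` S n|"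
    using inj_on_subset[OF inj SF] by (intro card_of_ordIsoI[of x]) (simp add: bij_betw_def)
  then have "|x ` S n| =o \<kappa>" using n ordIso_symmetric ordIso_transitive by blast
  moreover have "x ` S n \<subseteq> sphere 0 1" using s'(1) SF by auto
  moreover have "symmetrically_separated (1 + 1 / real (Suc n)) (x ` S n)"
    unfolding symmetrically_separated_def
  proof (intro ballI impI)
    fix v w assume "v \<in> x ` S n" "w \<in> x ` S n" "v \<noteq> w"
    then obtain a b where ab: "a \<in> S n" "b \<in> S n" "v = x a" "w = x b" "a \<noteq> b"
      by blast
    then have le: "1 / real (Suc n) \<le> min (\<eta> a) (\<eta> b)"
      and F: "a \<in> Field \<kappa>" "b \<in> Field \<kappa>"
      by (simp_all add: S_def)
    show "1 + 1 / real (Suc n) \<le> norm (v - w) \<and> 1 + 1 / real (Suc n) \<le> norm (v + w)"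
      unfolding ab(3,4) using sep2[OF F ab(5)] le by (intro conjI) linarith+
  qed
  ultimately have "x ` S n \<subseteq> sphere 0 1 \<and> symmetrically_separated (1 + 1 / real (Suc n)) (x ` S n) \<and> |x ` S n| =o \<kappa>"
    by simp
  moreover have "0 < 1 / real (Suc n)" by simp
  ultimately show ?thesis by blast
qed

end
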